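(* Let $\Delta$ be a balanced combinatorial $d$-manifold with boundary. Let $\Gamma=\langle\Gamma_{i_1},\dots,\Gamma_{i_k}\rangle\subseteq\partial\sigma^{d+1}$ with $i_1,\dots,i_k\in\{0,\dots,d+1\}$ pairwise distinct and $i_2<\dots<i_k$, and let $\Diamond(\Gamma)$ be an induced subcomplex of $\Delta$ intersecting $\partial\Delta$ in a $(d-1)$-face $F\in\Diamond(\Gamma_{i_1})$; let $G$ be the unique facet of $\Diamond(\Gamma_{i_1})$ containing $F$. Define $F^{(1)}_{\mathrm{in}}=G$ and, for $2\le\ell\le k$, $F^{(\ell)}_{\mathrm{in}}=\{0,\dots,i_\ell-1,v_{i_\ell}\}\cup\{i_\ell+1,\dots,i_{m(\ell)}-1\}\cup\{v_{i_{m(\ell)}},\dots,v_d\}$, where $i_{m(\ell)}=\min\{i_j:1\le j\le\ell, i_j\ge i_\ell\}$ (and $F^{(\ell)}_{\mathrm{in}}=\{0,\dots,d\}$ if $i_\ell=d+1$). For $1\le\ell\le k$ let $r_\ell=|\mathcal{F}(\Diamond(\Gamma_{i_\ell}))|-1$ and let $F^{(\ell)}_0=F^{(\ell)}_{\mathrm{in}},F^{(\ell)}_1,\dots,F^{(\ell)}_{r_\ell}$ be the facets of $\Diamond(\Gamma_{i_\ell})$ in degree lexicographic order with respect to $F^{(\ell)}_{\mathrm{in}}$. Then $$F^{(k)}_{r_k},\dots,F^{(k)}_1,F^{(k)}_0,\ F^{(k-1)}_{r_{k-1}},\dots,F^{(k-1)}_0,\ \dots,\ F^{(1)}_{r_1},\dots,F^{(1)}_1,F^{(1)}_0$$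 is a shelling of the relative complex $\bigl(\Delta,\Delta\setminus\bigcup_{j=1}^k\Diamond(\Gamma_{i_j})\bigr)$.
   Context: Balanced, combinatorial manifold with boundary, $\partial\Delta$: as usual (proper $(d+1)$-coloring; connected complex with all face links PL spheres or balls; boundary generated by $(d-1)$-faces in exactly one facet). $\sigma^{d+1}$ is the simplex on $\{0,\dots,d+1\}$, $\Gamma_i=\{0,\dots,d+1\}\setminus\{i\}$. $\Diamond(\Gamma)$: for $i=0,\dots,d$ in order, if $F_i=\{i+1,\dots,d+1\}$ is a face of the current complex $K$, replace $K$ by $(K\setminus F_i)\cup(\langle v_i\rangle*\partial F_i*\mathrm{lk}_K(F_i))$ (new vertex $v_i$). For $i\le d$, each facet of $\Diamond(\Gamma_i)$ has the form $\{0,\dots,i-1,v_i\}\cup F'$ where $F'$ contains exactly one of $j,v_j$ for each $i<j\le d$; for two such facets $H,F$ define $\varphi_F(H)\in\{0,1\}^{d-i}$ whose coordinate for $j=i+1,\dots,d$ is $0$ if $H$ and $F$ contain the same element of $\{j,v_j\}$ and $1$ otherwise, and $\deg_F(H)$ the number of ones. The degree lexicographic order with respect to $F$ puts $H\prec H'$ if $\deg_F(H)<\deg_F(H')$, or the degrees are equal and at the first coordinate where $\varphi_F(H),\varphi_F(H')$ differ, $\varphi_F(H)$ has $0$ ($\Diamond(\Gamma_{d+1})$ has the single facet $\{0,\dots,d\}$). For a subcomplex $K'$, $\Delta\setminus K'$ is generated by the facets of $\Delta$ not in $K'$. A shelling of a relative complex $(\Delta,\Delta_0)$, $\Delta_0\subseteq\Delta$,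 is an ordering $H_1,\dots,H_m$ of the facets of $\Delta$ not in $\Delta_0$ such that for each $i$ the set $\{S\subseteq H_i: S\notin\Delta_0,\ S\not\subseteq H_j \text{ for } j<i\}$ has a unique minimal element.
   Formalization: The formula for i_{m(ℓ)} is corrected to min{i_j : 1≤j≤ℓ, i_j > i_ℓ}, or i_ℓ if no such j exists; as printed (i_j ≥ i_ℓ) it is always i_ℓ and the claim fails, e.g. d=1, (i_1,i_2)=(2,0), F={0}, Δ the path 0,1,v_0,v_1,w. *)

theory Defs
  imports "HOL-Analysis.Analysis"
begin

section \<open>Abstract simplicial complexes\<close>

text \<open>A complex is the set of all its faces, the empty face included.  The void complex \<open>{}\<close>
  is allowed; it is the complex generated by no faces at all.\<close>

definition abstract_complex :: "'v set set \<Rightarrow> bool" where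
  "abstract_complex K \<longleftrightarrow>
     finite K \<and> (\<forall>S\<in>K. finite S) \<and> (\<forall>S\<in>K. \<forall>T. T \<subseteq> S \<longrightarrow> T \<in> K)"

definition generated_complex :: "'v set set \<Rightarrow> 'v set set" where
  "generated_complex A = {S. \<exists>T\<in>A. S \<subseteq> T}"

definition facets :: "'v set set \<Rightarrow> 'v set set" where
  "facets K = {S\<in>K. \<forall>T\<in>K. S \<subseteq> T \<longrightarrow> T = S}"

definition link :: "'v set set \<Rightarrow> 'v set \<Rightarrow> 'v set set" where
  "link K S = {T. T \<inter> S = {} \<and> T \<union> S \<in> K}"

definition complex_join :: "'v set set \<Rightarrow> 'v set set \<Rightarrow> 'v set set" where
  "complex_join K L = {S \<union> T | S T. S \<in> K \<and> T \<in> L}"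

definition induced_subcomplex :: "'v set set \<Rightarrow> 'v set set \<Rightarrow> bool" where
  "induced_subcomplex D K \<longleftrightarrow> D \<subseteq> K \<and> (\<forall>S\<in>K. S \<subseteq> \<Union>D \<longrightarrow> S \<in> D)"

definition complex_image :: "('v \<Rightarrow> 'w) \<Rightarrow> 'v set set \<Rightarrow> 'w set set" where
  "complex_image f K = (\<lambda>S. f ` S) ` K"

text \<open>The subcomplex of \<open>K\<close> generated by the facets of \<open>K\<close> that are not in \<open>L\<close>.\<close>

definition complex_diff :: "'v set set \<Rightarrow> 'v set set \<Rightarrow> 'v set set" where
  "complex_diff K L = generated_complex (facets K - L)"

section \<open>Combinatorial manifolds\<close>

text \<open>Points of the geometric realization are given by their barycentric coordinates; the
  topology is that of the product space \<open>'v \<Rightarrow> real\<close>.\<close>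

definition realization :: "'v set set \<Rightarrow> ('v \<Rightarrow> real) set" where
  "realization K =
     {x. (\<forall>v. 0 \<le> x v) \<and> {v. x v \<noteq> 0} \<in> K \<and> (\<Sum>v\<in>{v. x v \<noteq> 0}. x v) = 1}"

text \<open>\<open>M\<close> is (isomorphic to) a subdivision of \<open>K\<close>: there is a homeomorphism of realizations that
  is affine on each closed simplex of \<open>M\<close> and maps it into a closed simplex of \<open>K\<close>.\<close>

definition subdivides :: "'m set set \<Rightarrow> 'v set set \<Rightarrow> bool" where
  "subdivides M K \<longleftrightarrow>
     (\<exists>h g. homeomorphism (realization M) (realization K) h g \<and>
        (\<forall>S\<in>M. \<exists>T\<in>K. h ` realization (Pow S) \<subseteq> realization (Pow T)) \<and>
        (\<forall>S\<in>M. \<forall>x\<in>realization (Pow S). \<forall>y\<in>realization (Pow S). \<forall>t\<in>{0..1}.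
           h (\<lambda>u. (1 - t) * x u + t * y u) = (\<lambda>v. (1 - t) * h x v + t * h y v)))"

text \<open>Two complexes are PL homeomorphic if they have isomorphic subdivisions.  Complexes are
  finite, so the type of the vertices of the common subdivision does not matter.\<close>

definition pl_homeomorphic :: "'v set set \<Rightarrow> 'w set set \<Rightarrow> bool" where
  "pl_homeomorphic K L \<longleftrightarrow>
     (\<exists>M :: nat set set. abstract_complex M \<and> subdivides M K \<and> subdivides M L)"

text \<open>The dimension is an integer because the link of a facet is the \<open>(-1)\<close>-sphere \<open>{{}}\<close>.\<close>

definition pl_sphere :: "int \<Rightarrow> 'v set set \<Rightarrow> bool" where
  "pl_sphere n K \<longleftrightarrow> pl_homeomorphic K {S. S \<subset> {j :: nat. int j \<le> n + 1}}"

definition pl_ball :: "int \<Rightarrow> 'v set set \<Rightarrow> bool" where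
  "pl_ball n K \<longleftrightarrow> 0 \<le> n \<and> pl_homeomorphic K (Pow {j :: nat. int j \<le> n})"

definition combinatorial_manifold_with_boundary :: "nat \<Rightarrow> 'v set set \<Rightarrow> bool" where
  "combinatorial_manifold_with_boundary d K \<longleftrightarrow>
     abstract_complex K \<and>
     (\<exists>S\<in>K. card S = d + 1) \<and> (\<forall>S\<in>K. card S \<le> d + 1) \<and>
     connected (realization K) \<and>
     (\<forall>S\<in>K. S \<noteq> {} \<longrightarrow>
        pl_sphere (int d - int (card S)) (link K S) \<or>
        pl_ball (int d - int (card S)) (link K S))"

definition manifold_boundary :: "nat \<Rightarrow> 'v set set \<Rightarrow> 'v set set" where
  "manifold_boundary d K =
     generated_complex {R\<in>K. card R = d \<and> card {H\<in>facets K. R \<subseteq> H} = 1}"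

definition balanced :: "nat \<Rightarrow> 'v set set \<Rightarrow> bool" where
  "balanced d K \<longleftrightarrow>
     (\<exists>\<kappa> :: 'v \<Rightarrow> nat. \<kappa> ` \<Union>K \<subseteq> {0..d} \<and> (\<forall>S\<in>K. inj_on \<kappa> S))"

section \<open>Relative shellings\<close>

definition relative_shelling :: "'v set set \<Rightarrow> 'v set set \<Rightarrow> 'v set list \<Rightarrow> bool" where
  "relative_shelling K L Hs \<longleftrightarrow>
     abstract_complex K \<and> abstract_complex L \<and> L \<subseteq> K \<and>
     distinct Hs \<and> set Hs = facets K - L \<and>
     (\<forall>i<length Hs. \<exists>!S.
        S \<in> {T. T \<subseteq> Hs ! i \<and> T \<notin> L \<and> (\<forall>j<i. \<not> T \<subseteq> Hs ! j)} \<and>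
        (\<forall>S'\<in>{T. T \<subseteq> Hs ! i \<and> T \<notin> L \<and> (\<forall>j<i. \<not> T \<subseteq> Hs ! j)}. S' \<subseteq> S \<longrightarrow> S' = S))"

section \<open>The diamond operation\<close>

text \<open>\<open>Old j\<close> is the vertex \<open>j\<close> of the simplex \<open>\<sigma>\<close> on \<open>{0,\<dots>,d+1}\<close>, and \<open>New j\<close> is the vertex
  \<open>v\<^sub>j\<close>.\<close>

datatype dvertex = Old nat | New nat

definition simplex_facet :: "nat \<Rightarrow> nat \<Rightarrow> dvertex set" where
  "simplex_facet d i = Old ` ({0..d+1} - {i})"

text \<open>Stellar subdivision at the face \<open>S\<close> with new vertex \<open>w\<close>.  The first part is the deletion
  of the face \<open>S\<close> (all faces containing \<open>S\<close> are removed), not \<open>complex_diff\<close>.\<close>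

definition stellar_subdivision :: "'v set \<Rightarrow> 'v \<Rightarrow> 'v set set \<Rightarrow> 'v set set" where
  "stellar_subdivision S w K =
     {T\<in>K. \<not> S \<subseteq> T} \<union>
     complex_join {{}, {w}} (complex_join {T. T \<subset> S} (link K S))"

definition diamond_step :: "nat \<Rightarrow> nat \<Rightarrow> dvertex set set \<Rightarrow> dvertex set set" where
  "diamond_step d i K =
     (if Old ` {i+1..d+1} \<in> K then stellar_subdivision (Old ` {i+1..d+1}) (New i) K else K)"

definition diamond :: "nat \<Rightarrow> dvertex set set \<Rightarrow> dvertex set set" where
  "diamond d K = fold (diamond_step d) [0..<d+1] K"

abbreviation diamond_facet :: "nat \<Rightarrow> nat \<Rightarrow> dvertex set set" where
  "diamond_facet d i \<equiv> diamond d (generated_complex {simplex_facet d i})"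

section \<open>The degree lexicographic order\<close>

definition dl_phi :: "dvertex set \<Rightarrow> dvertex set \<Rightarrow> nat \<Rightarrow> nat" where
  "dl_phi F H j = (if H \<inter> {Old j, New j} = F \<inter> {Old j, New j} then 0 else 1)"

definition dl_deg :: "nat \<Rightarrow> nat \<Rightarrow> dvertex set \<Rightarrow> dvertex set \<Rightarrow> nat" where
  "dl_deg d i F H = (\<Sum>j\<in>{i+1..d}. dl_phi F H j)"

text \<open>The order on the facets of \<open>diamond_facet d i\<close>, with respect to the facet \<open>F\<close>.\<close>

definition deglex_less ::
  "nat \<Rightarrow> nat \<Rightarrow> dvertex set \<Rightarrow> dvertex set \<Rightarrow> dvertex set \<Rightarrow> bool" where
  "deglex_less d i F H H' \<longleftrightarrow>
     dl_deg d i F H < dl_deg d i F H' \<or>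
     dl_deg d i F H = dl_deg d i F H' \<and>
       (\<exists>t\<in>{i+1..d}. (\<forall>s\<in>{i+1..<t}. dl_phi F H s = dl_phi F H' s) \<and>
          dl_phi F H t = 0 \<and> dl_phi F H' t = 1)"

text \<open>The value \<open>i\<^bsub>m(\<ell>)\<^esub>\<close> is the least \<open>i\<^sub>j\<close> with \<open>j \<le> \<ell>\<close> that is strictly greater than
  \<open>i\<^sub>\<ell>\<close>, and \<open>i\<^sub>\<ell>\<close> itself if there is none.  This corrects the formula
  \<open>min {i\<^sub>j | j \<le> \<ell>, i\<^sub>j \<ge> i\<^sub>\<ell>}\<close>, where \<open>j = \<ell>\<close> makes the minimum always \<open>i\<^sub>\<ell>\<close>.
  That is wrong when \<open>i\<^sub>1 > i\<^sub>\<ell>\<close>: for \<open>d = 1\<close>, \<open>(i\<^sub>1, i\<^sub>2) = (2, 0)\<close>, \<open>F = {0}\<close> and the path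
  \<open>0, 1, v\<^sub>0, v\<^sub>1, w\<close> as manifold, the sequence would start with the edge \<open>{1, v\<^sub>0}\<close> in the middle
  of the path, which violates the shelling condition.\<close>

definition next_index :: "(nat \<Rightarrow> nat) \<Rightarrow> nat \<Rightarrow> nat" where
  "next_index i l =
     (if \<exists>j\<in>{1..l}. i j > i l then Min {i j | j. j \<in> {1..l} \<and> i j > i l} else i l)"

definition initial_facet ::
  "nat \<Rightarrow> (nat \<Rightarrow> nat) \<Rightarrow> dvertex set \<Rightarrow> nat \<Rightarrow> dvertex set" where
  "initial_facet d i G l =
     (if l = 1 then G
      else if i l = d + 1 then Old ` {0..d}
      else Old ` {0..<i l} \<union> {New (i l)} \<union>
           Old ` {i l + 1..<next_index i l} \<union> New ` {next_index i l..d})"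

end

theory Submission
  imports Defs
begin

text \<open>A face \<open>S\<close> of the facet \<open>H\<close> is new at the step where \<open>H\<close> is added if and only if all facets
  of \<open>\<Delta>\<close> containing \<open>S\<close> are in \<open>W\<close>, which consists of \<open>H\<close> and the facets added later.  Hence
  \<open>S\<close> must contain the set \<open>R\<close> of those vertices of \<open>H\<close> whose opposite ridge is in a facet outside
  \<open>W\<close>.  Stars of faces in a manifold are strongly connected and a ridge is in at most two facets, so \<open>R\<close> itself is new as
  soon as \<open>W\<close> contains all facets of the cross-polytope boundary that contain \<open>R\<close>.  Identifying
  these facets with subsets of \<open>{0..d}\<close>, this is a statement about subcubes of a discrete cube,
  which follows from the form of the degree lexicographic order.  The facet \<open>G\<close> is exceptional: it
  comes last, \<open>W = {G}\<close>, and \<open>R = F\<close> since \<open>F\<close> is a boundary ridge.\<close>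

section \<open>Realizations\<close>

text \<open>Pseudomanifold properties come from the links through invariants of homeomorphism: links
  of dimension at least 0 are nonempty, which gives purity; those of dimension at least 1 are
  connected, which makes stars strongly connected; those of dimension 0 have at most two points,
  which bounds the number of facets at a ridge. The cube statement has content because only single
  flips of \<open>A\<close> are known to come earlier, while the conclusion concerns all
  combinations of them. Flips above \<open>i l\<close> within a block move towards the initial
  facet, so they lower the degree jointly as well. The obstacle is that \<open>i 1\<close> may be
  out of order: if it exceeds \<open>i l\<close>, dropping \<open>i l\<close> can lead into block
  \<open>i 1\<close>, which comes earlier although its index is larger. The initial facets are
  chosen so that the other flips are compatible with this one.\<close>

lemma support_singleton [simp]: "{u. (if u = v then 1 else (0::real)) \<noteq> 0} = {v}"
  by auto

lemma vertex_in_realization: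
  assumes "{v} \<in> K"
  shows "(\<lambda>u. if u = v then 1 else 0) \<in> realization K"
  using assms by (simp add: realization_def)

lemma realization_support:
  assumes "x \<in> realization K"
  shows "{v. x v \<noteq> 0} \<in> K" "finite {v. x v \<noteq> 0}" "{v. x v \<noteq> 0} \<noteq> {}"
  using assms by (auto simp: realization_def intro: ccontr)

lemma realization_sum:
  assumes "x \<in> realization K" "finite S" "{v. x v \<noteq> 0} \<subseteq> S"
  shows "(\<Sum>v\<in>S. x v) = 1"
proof -
  have "(\<Sum>v\<in>{v. x v \<noteq> 0}. x v) = (\<Sum>v\<in>S. x v)"
    by (rule sum.mono_neutral_left) (use assms in auto)
  with assms show ?thesis by (simp add: realization_def)
qed

lemma path_component_realization_segment:
  assumes K: "\<forall>S\<in>K. \<forall>T. T \<subseteq> S \<longrightarrow> T \<in> K"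
    and x: "x \<in> realization K" and y: "y \<in> realization K"
    and xy: "{v. x v \<noteq> 0} \<union> {v. y v \<noteq> 0} \<in> K"
  shows "path_component (realization K) x y"
proof -
  let ?S = "{v. x v \<noteq> 0} \<union> {v. y v \<noteq> 0}"
  let ?g = "\<lambda>t::real. \<lambda>v. (1 - t) * x v + t * y v"
  have fin: "finite ?S" using realization_support x y by blast
  have "?g t \<in> realization K" if t: "t \<in> {0..1}" for t
  proof -
    have sub: "{v. ?g t v \<noteq> 0} \<subseteq> ?S" by auto
    have "(\<Sum>v\<in>{v. ?g t v \<noteq> 0}. ?g t v) = (\<Sum>v\<in>?S. ?g t v)"
      by (rule sum.mono_neutral_left[OF fin sub]) auto
    also have "\<dots> = (1 - t) * (\<Sum>v\<in>?S. x v) + t * (\<Sum>v\<in>?S. y v)"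
      by (simp add: sum.distrib sum_distrib_left)
    also have "\<dots> = 1"
      using realization_sum[OF x fin] realization_sum[OF y fin] by simp
    finally have 1: "(\<Sum>v\<in>{v. ?g t v \<noteq> 0}. ?g t v) = 1" .
    have 2: "0 \<le> ?g t v" for v
      using x y t by (auto simp: realization_def)
    show ?thesis
      unfolding realization_def using 1 2 K xy sub by blast
  qed
  moreover have "continuous_on {0..1} ?g"
    by (intro continuous_on_coordinatewise_then_product continuous_intros)
  ultimately show ?thesis
    unfolding path_component_def path_def path_image_def pathstart_def pathfinish_def
    by (intro exI[of _ ?g]) auto
qed

text \<open>A segment joins every point to a vertex of its support, and an edge joins any two
  vertices. This covers the simplex and, from dimension 1 on, its boundary sphere.\<close>

lemma connected_realization_complete_graph:
  assumes K: "\<forall>S\<in>K. \<forall>T. T \<subseteq> S \<longrightarrow> T \<in> K"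
    and e: "\<And>a b. {a} \<in> K \<Longrightarrow> {b} \<in> K \<Longrightarrow> {a, b} \<in> K"
  shows "connected (realization K)"
proof -
  let ?e = "\<lambda>v u. if u = v then 1 else (0::real)"
  have v: "path_component (realization K) (?e a) (?e b)" if "{a} \<in> K" "{b} \<in> K" for a b
    by (rule path_component_realization_segment[OF K])
      (use that e vertex_in_realization[OF that(1)] vertex_in_realization[OF that(2)] in
        \<open>auto simp: insert_commute\<close>)
  have x: "\<exists>a. {a} \<in> K \<and> path_component (realization K) x (?e a)" if x: "x \<in> realization K" for x
  proof -
    obtain a where a: "x a \<noteq> 0" using realization_support(3)[OF x] by auto
    have aK: "{a} \<in> K" using a realization_support(1)[OF x] K by auto
    have "{v. x v \<noteq> 0} \<union> {v. ?e a v \<noteq> 0} = {v. x v \<noteq> 0}" using a by auto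
    with path_component_realization_segment[OF K x vertex_in_realization[OF aK]] 
      realization_support(1)[OF x] aK show ?thesis by auto
  qed
  have "path_connected (realization K)"
    unfolding path_connected_component
    using x v by (meson path_component_sym path_component_trans)
  then show ?thesis by (rule path_connected_imp_connected)
qed

text \<open>The total weight of the vertices in \<open>A\<close> is continuous on the realization, and it takes only
  the values 0 and 1 if no edge leaves \<open>A\<close>.\<close>

lemma connected_realization_vertex_induct:
  assumes K: "abstract_complex K" and conn: "connected (realization K)"
    and a: "{a} \<in> K" "a \<in> A" and c: "{c} \<in> K"
    and closed: "\<And>u v. u \<in> A \<Longrightarrow> {u, v} \<in> K \<Longrightarrow> v \<in> A"
  shows "c \<in> A"
proof (rule ccontr)
  assume cA: "c \<notin> A"
  let ?V = "A \<inter> \<Union>K"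
  let ?f = "\<lambda>x. \<Sum>v\<in>?V. x v :: real"
  have fin: "finite ?V" using K by (auto simp: abstract_complex_def)
  have "continuous_on (realization K) ?f"
    by (intro continuous_intros continuous_on_product_then_coordinatewise continuous_on_id)
  then have conn': "connected (?f ` realization K)"
    using conn by (rule connected_continuous_image)
  have "1 \<in> ?f ` realization K"
  proof (rule image_eqI[OF _ vertex_in_realization[OF a(1)]])
    have "?f (\<lambda>u. if u = a then 1 else 0) = (if a \<in> ?V then 1 else 0)"
      using fin by simp
    then show "1 = ?f (\<lambda>u. if u = a then 1 else 0)" using a by auto
  qed
  moreover have "0 \<in> ?f ` realization K"
  proof (rule image_eqI[OF _ vertex_in_realization[OF c]])
    have "?f (\<lambda>u. if u = c then 1 else 0) = (if c \<in> ?V then 1 else 0)"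
      using fin by simp
    then show "0 = ?f (\<lambda>u. if u = c then 1 else 0)" using cA by auto
  qed
  ultimately have "1/2 \<in> ?f ` realization K"
    using connectedD_interval[OF conn', of 0 1 "1/2"] by simp
  then obtain x where x: "x \<in> realization K" and half: "?f x = 1/2" by auto
  let ?S = "{v. x v \<noteq> 0}"
  note S = realization_support[OF x]
  show False
  proof (cases "?S \<inter> A = {}")
    case True
    then have "?f x = 0" by (intro sum.neutral) auto
    with half show False by simp
  next
    case False
    then obtain u where u: "u \<in> ?S" "u \<in> A" by auto
    have "?S \<subseteq> ?V"
    proof
      fix w assume w: "w \<in> ?S"
      have "{u, w} \<in> K"
        using u w S(1) K unfolding abstract_complex_def
        by (metis (no_types, lifting) empty_subsetI insert_subset)
      with u closed show "w \<in> ?V" by blast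
    qed
    with realization_sum[OF x fin] half show False by simp
  qed
qed

lemma pl_homeomorphic_imp_homeomorphic:
  assumes "pl_homeomorphic K L"
  shows "realization K homeomorphic realization L"
proof -
  from assms obtain M :: "nat set set" where "subdivides M K" "subdivides M L"
    by (auto simp: pl_homeomorphic_def)
  then have "realization M homeomorphic realization K" "realization M homeomorphic realization L"
    by (auto simp: subdivides_def homeomorphic_def)
  then show ?thesis by (rule homeomorphic_trans[OF homeomorphic_sym[THEN iffD1]])
qed

lemma pl_sphere_or_ball_connected:
  assumes "1 \<le> n" "pl_sphere n K \<or> pl_ball n K"
  shows "connected (realization K)"
proof -
  have "connected (realization {S. S \<subset> {j :: nat. int j \<le> n + 1}})"
  proof (rule connected_realization_complete_graph)
    fix a b assume ab: "{a} \<in> {S. S \<subset> {j :: nat. int j \<le> n + 1}}" "{b} \<in> {S. S \<subset> {j :: nat. int j \<le> n + 1}}"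
    \<comment> \<open>For \<open>1 \<le> n\<close> the sphere model has at least three vertices, so
      every pair is a proper subset and hence a face. The 0-sphere fails here.\<close>
    have "{0, 1, 2} \<subseteq> {j :: nat. int j \<le> n + 1}" using assms by auto
    moreover have "\<not> {0, 1, 2} \<subseteq> {a, b}" by auto
    ultimately show "{a, b} \<in> {S. S \<subset> {j :: nat. int j \<le> n + 1}}" using ab by blast
  qed auto
  moreover have "connected (realization (Pow {j :: nat. int j \<le> n}))"
    by (rule connected_realization_complete_graph) auto
  ultimately show ?thesis
    using assms(2) unfolding pl_sphere_def pl_ball_def
    by (metis homeomorphic_connectedness pl_homeomorphic_imp_homeomorphic)
qed

text \<open>Separates dimension at least 0 from the \<open>(-1)\<close>-sphere \<open>{{}}\<close>,
  whose realization is empty. Purity of manifolds rests on this.\<close>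

lemma pl_sphere_or_ball_nonempty:
  assumes "0 \<le> n" "pl_sphere n K \<or> pl_ball n K"
  shows "realization K \<noteq> {}"
proof -
  have "{0} \<in> {S. S \<subset> {j :: nat. int j \<le> n + 1}}"
  proof -
    have "0 \<in> {j :: nat. int j \<le> n + 1}" "1 \<in> {j :: nat. int j \<le> n + 1}" using assms by auto
    then show ?thesis by fastforce
  qed
  from vertex_in_realization[OF this]
  have "realization {S. S \<subset> {j :: nat. int j \<le> n + 1}} \<noteq> {}"
    by (rule ex_in_conv[THEN iffD1, OF exI])
  moreover have "{0} \<in> Pow {j :: nat. int j \<le> n}"
    using assms by auto
  from vertex_in_realization[OF this]
  have "realization (Pow {j :: nat. int j \<le> n}) \<noteq> {}"
    by (rule ex_in_conv[THEN iffD1, OF exI])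
  ultimately show ?thesis
    using assms(2) unfolding pl_sphere_def pl_ball_def
    using homeomorphic_empty pl_homeomorphic_imp_homeomorphic by metis
qed

lemma realization_zero_dim:
  assumes "\<And>S. S \<in> K \<Longrightarrow> S \<noteq> {} \<Longrightarrow> \<exists>v\<in>V. S = {v}" 
  shows "realization K \<subseteq> (\<lambda>v u. if u = v then 1 else 0) ` V"
proof
  fix x assume x: "x \<in> realization K"
  obtain v where v: "v \<in> V" "{u. x u \<noteq> 0} = {v}"
    using assms realization_support[OF x] by metis
  have "x v = 1" using realization_sum[OF x, of "{v}"] v by simp
  then have "x = (\<lambda>u. if u = v then 1 else 0)"
    using v(2) by (intro ext) (metis (mono_tags, lifting) mem_Collect_eq singletonD)
  with v(1) show "x \<in> (\<lambda>v u. if u = v then 1 else 0) ` V" by auto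
qed

text \<open>Counting: distinct vertices are distinct points of the realization, a homeomorphism is
  injective, and both 0-dimensional models have at most two points.\<close>

lemma pl_0_sphere_or_ball_vertices:
  fixes K :: "'a set set"
  assumes "pl_sphere 0 K \<or> pl_ball 0 K" and v: "{a} \<in> K" "{b} \<in> K" "{c} \<in> K"
  shows "a = b \<or> a = c \<or> b = c"
proof -
  let ?e = "\<lambda>(v::'a) u. if u = v then 1 else (0::real)"
  let ?e' = "\<lambda>(v::nat) u. if u = v then 1 else (0::real)"
  have "{j :: nat. int j \<le> 0 + 1} = {0, 1}" by auto
  then have "realization {S. S \<subset> {j :: nat. int j \<le> 0 + 1}} \<subseteq> ?e' ` {0, 1}"
    by (intro realization_zero_dim) auto
  moreover have "realization (Pow {j :: nat. int j \<le> 0}) \<subseteq> ?e' ` {0, 1}"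
    by (rule realization_zero_dim) auto
  ultimately obtain L :: "nat set set" where L: "realization L \<subseteq> ?e' ` {0, 1}" "realization K homeomorphic realization L"
    using assms(1) unfolding pl_sphere_def pl_ball_def
    by (metis pl_homeomorphic_imp_homeomorphic)
  from L(2) obtain h g where h: "homeomorphism (realization K) (realization L) h g"
    by (auto simp: homeomorphic_def)
  have inj: "inj_on h (realization K)"
    using h by (intro inj_on_inverseI[of _ g]) (auto simp: homeomorphism_def)
  define W where "W = ?e ` {a, b, c}"
  have inje: "inj ?e"
  proof (rule injI)
    fix p q :: 'a assume "?e p = ?e q"
    from fun_cong[OF this, of p] show "p = q" by (simp split: if_splits)
  qed
  show ?thesis
  proof (rule ccontr)
    assume ne: "\<not> ?thesis"
    have sub: "W \<subseteq> realization K"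
      unfolding W_def using v by (auto intro!: vertex_in_realization)
    have "card W = card {a, b, c}"
      unfolding W_def by (rule card_image) (rule inj_on_subset[OF inje subset_UNIV])
    also have "\<dots> = 3" using ne by simp
    finally have "card W = 3" .
    moreover have "card (h ` W) = card W"
      by (rule card_image) (rule inj_on_subset[OF inj sub])
    moreover have "h ` W \<subseteq> ?e' ` {0, 1}"
      by (rule order_trans[OF image_mono[OF sub, of h]])
        (simp only: homeomorphism_image1[OF h] L(1))
    then have "card (h ` W) \<le> card (?e' ` {0, 1})"
      by (intro card_mono) auto
    moreover have "card (?e' ` {0, 1}) \<le> card {0, 1 :: nat}"
      by (rule card_image_le) simp
    moreover have "card {0, 1 :: nat} = 2" by simp
    ultimately show False by linarith
  qed
qed

section \<open>Combinatorial manifolds\<close>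

lemma abstract_complex_link:
  assumes "abstract_complex K"
  shows "abstract_complex (link K S)"
proof -
  have "link K S \<subseteq> K"
    using assms by (auto simp: abstract_complex_def link_def)
  then have "finite (link K S)"
    using assms by (meson abstract_complex_def finite_subset)
  moreover have "T' \<in> link K S" if "T \<in> link K S" "T' \<subseteq> T" for T T'
  proof -
    have "T' \<union> S \<subseteq> T \<union> S" "T' \<inter> S = {}" using that by (auto simp: link_def)
    then show ?thesis using assms that by (auto simp: link_def abstract_complex_def)
  qed
  ultimately show ?thesis
    using assms \<open>link K S \<subseteq> K\<close> by (auto simp: abstract_complex_def)
qed

lemma link_empty [simp]: "link K {} = K"
  by (simp add: link_def)

lemma abstract_complex_generated_complex:
  assumes "finite A" "\<forall>S\<in>A. finite S"
  shows "abstract_complex (generated_complex A)"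
proof -
  have "generated_complex A = (\<Union>S\<in>A. Pow S)" by (auto simp: generated_complex_def)
  with assms show ?thesis
    by (auto simp: abstract_complex_def intro: finite_subset) blast
qed

lemma face_in_facet:
  assumes K: "abstract_complex K" and S: "S \<in> K"
  obtains X where "X \<in> facets K" "S \<subseteq> X"
proof -
  have "finite {T\<in>K. S \<subseteq> T}" using K by (auto simp: abstract_complex_def)
  moreover have "S \<in> {T\<in>K. S \<subseteq> T}" using S by simp
  ultimately obtain X where X: "X \<in> {T\<in>K. S \<subseteq> T}" "\<forall>T\<in>{T\<in>K. S \<subseteq> T}. X \<subseteq> T \<longrightarrow> X = T"
    using finite_has_maximal[of "{T\<in>K. S \<subseteq> T}"] by blast
  then have "X \<in> facets K" by (auto simp: facets_def)
  with X that show ?thesis by blast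
qed

context
  fixes d :: nat and K :: "'v set set"
  assumes manifold: "combinatorial_manifold_with_boundary d K"
begin

lemma manifold_complex: "abstract_complex K"
  using manifold by (simp add: combinatorial_manifold_with_boundary_def)

lemma manifold_face_subset: "S \<in> K \<Longrightarrow> T \<subseteq> S \<Longrightarrow> T \<in> K"
  using manifold_complex by (auto simp: abstract_complex_def)

lemma manifold_face_finite: "S \<in> K \<Longrightarrow> finite S"
  using manifold_complex by (auto simp: abstract_complex_def)

lemma manifold_face_card: "S \<in> K \<Longrightarrow> card S \<le> d + 1"
  using manifold by (simp add: combinatorial_manifold_with_boundary_def)

lemma manifold_link:
  "S \<in> K \<Longrightarrow> S \<noteq> {} \<Longrightarrow>
    pl_sphere (int d - int (card S)) (link K S) \<or> pl_ball (int d - int (card S)) (link K S)"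
  using manifold by (simp add: combinatorial_manifold_with_boundary_def)

text \<open>The link of a facet has no nonempty face, so its realization is empty; a link of
  dimension at least 0 would have points.\<close>

lemma manifold_facet_iff: "X \<in> facets K \<longleftrightarrow> X \<in> K \<and> card X = d + 1"
proof
  assume X: "X \<in> facets K"
  then have XK: "X \<in> K" by (simp add: facets_def)
  \<comment> \<open>The link condition speaks of nonempty faces only.\<close>
  have "X \<noteq> {}"
  proof
    assume "X = {}"
    moreover obtain S where "S \<in> K" "card S = d + 1"
      using manifold by (auto simp: combinatorial_manifold_with_boundary_def)
    ultimately show False using X by (auto simp: facets_def)
  qed
  have "link K X \<subseteq> {{}}"
    using X by (fastforce simp: link_def facets_def)
  then have "realization (link K X) = {}"
    by (auto simp: realization_def)
  then have "\<not> 0 \<le> int d - int (card X)"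
    using pl_sphere_or_ball_nonempty manifold_link[OF XK \<open>X \<noteq> {}\<close>] by blast
  with manifold_face_card[OF XK] XK show "X \<in> K \<and> card X = d + 1" by simp
next
  assume X: "X \<in> K \<and> card X = d + 1"
  have "T = X" if "T \<in> K" "X \<subseteq> T" for T
    using card_seteq[of T X] manifold_face_card[OF that(1)] manifold_face_finite[OF that(1)] X that
    by simp
  with X show "X \<in> facets K" by (auto simp: facets_def)
qed

lemma manifold_link_connected:
  assumes "S \<in> K" "card S < d"
  shows "connected (realization (link K S))"
proof (cases "S = {}")
  case True
  then show ?thesis using manifold by (simp add: combinatorial_manifold_with_boundary_def)
next
  case False
  have "1 \<le> int d - int (card S)" using assms(2) by simp
  then show ?thesis using manifold_link[OF assms(1) False] by (rule pl_sphere_or_ball_connected)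
qed

text \<open>Facets through the ridge correspond to vertices of its link, a 0-dimensional sphere or
  ball.\<close>

lemma manifold_ridge_in_two_facets:
  assumes T: "card T = d" "finite T"
    and X: "X \<in> facets K" "T \<subseteq> X" and Y: "Y \<in> facets K" "T \<subseteq> Y" and Z: "Z \<in> facets K" "T \<subseteq> Z"
  shows "X = Y \<or> X = Z \<or> Y = Z"
proof -
  have v: "\<exists>v. X = insert v T \<and> v \<notin> T" if "X \<in> facets K" "T \<subseteq> X" for X
  proof -
    have "finite X" "card X = d + 1"
      using that manifold_facet_iff manifold_face_finite by auto
    then have "card (X - T) = 1" using T that by (simp add: card_Diff_subset)
    then obtain v where "X - T = {v}" by (auto simp: card_1_singleton_iff)
    then show ?thesis using that by blast
  qed
  obtain x y z where e: "X = insert x T" "Y = insert y T" "Z = insert z T"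
    and n: "x \<notin> T" "y \<notin> T" "z \<notin> T"
    using v X Y Z by metis
  have l: "{x} \<in> link K T" "{y} \<in> link K T" "{z} \<in> link K T"
    using X Y Z e n manifold_facet_iff by (auto simp: link_def)
  show ?thesis
  proof (cases "T = {}")
    case True
    \<comment> \<open>The empty ridge has no link condition. Instead, a connected complex of
      dimension 0 has only one vertex.\<close>
    then have "d = 0" using T by simp
    have "y \<in> {x}"
    proof (rule connected_realization_vertex_induct[OF manifold_complex])
      show "connected (realization K)"
        using manifold by (simp add: combinatorial_manifold_with_boundary_def)
      show "{x} \<in> K" "{y} \<in> K" using l True by auto
      fix u v assume "u \<in> {x}" "{u, v} \<in> K"
      then show "v \<in> {x}"
        using manifold_face_card[of "{u, v}"] \<open>d = 0\<close> by (auto simp: card_insert_if split: if_splits)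
    qed simp
    then show ?thesis using e by simp
  next
    case False
    have "T \<in> K" using X manifold_facet_iff manifold_face_subset by blast
    from manifold_link[OF this False] have "pl_sphere 0 (link K T) \<or> pl_ball 0 (link K T)"
      using T by simp
    from pl_0_sphere_or_ball_vertices[OF this l] show ?thesis using e by blast
  qed
qed

text \<open>Stars in a manifold are strongly connected: they are pure and all links of positive
  dimension are connected.\<close>

lemma manifold_star_induct:
  assumes X: "X \<in> \<U>" "R \<subseteq> X" and Y: "Y \<in> facets K" "R \<subseteq> Y" and U: "\<U> \<subseteq> facets K"
    and adj: "\<And>X' w Y'. X' \<in> \<U> \<Longrightarrow> R \<subseteq> X' \<Longrightarrow> w \<in> X' - R \<Longrightarrow> Y' \<in> facets K \<Longrightarrow> X' - {w} \<subseteq> Y'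
      \<Longrightarrow> Y' \<in> \<U>"
  shows "Y \<in> \<U>"
proof -
  \<comment> \<open>Generalized from \<open>R\<close> to every face \<open>S\<close> above it, for
    induction on the codimension of \<open>S\<close>. When \<open>S\<close> is a ridge,
    \<open>adj\<close> applies directly.\<close>
  have "Y \<in> \<U>" if "X \<in> \<U>" "S \<subseteq> X" "Y \<in> facets K" "S \<subseteq> Y" "R \<subseteq> S" for S X Y
    using that
  proof (induction "d + 1 - card S" arbitrary: S X Y)
    case 0
    have "X \<in> K" "Y \<in> K" "card X = d + 1" "card Y = d + 1" "finite X" "finite Y"
      using 0 U manifold_facet_iff manifold_face_finite by auto
    moreover have "d + 1 \<le> card S" using 0 by simp
    ultimately have "S = X" "S = Y"
      using 0 by (metis card_seteq)+
    then show ?case using 0 by simp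
  next
    case (Suc n)
    have XY: "X \<in> K" "Y \<in> K" "card X = d + 1" "card Y = d + 1" "finite X" "finite Y"
      using Suc.prems U manifold_facet_iff manifold_face_finite by auto
    have finS: "finite S" using Suc.prems XY finite_subset by blast
    have SK: "S \<in> K" using Suc.prems XY manifold_face_subset by blast
    have "card S \<le> d" using Suc.hyps(2) by simp
    then consider "card S = d" | "card S < d" by linarith
    then show ?case
    proof cases
      case 1
      then have "card (X - S) = 1" using XY Suc.prems finS by (simp add: card_Diff_subset)
      then obtain w where "X - S = {w}" by (auto simp: card_1_singleton_iff)
      then have "w \<in> X - R" "X - {w} \<subseteq> Y" using Suc.prems by auto
      then show ?thesis using adj[OF _ _ _ Suc.prems(3)] Suc.prems by blast
    next
      case 2
      \<comment> \<open>By the induction hypothesis for \<open>insert v S\<close>, one facet through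
        it in \<open>\<U>\<close> puts all of them there. A facet through an edge
        \<open>{u, v}\<close> of the link thus carries the property from \<open>u\<close> to
        \<open>v\<close>, and connectedness of the link does the rest.\<close>
      define A where "A = {v. \<forall>Z\<in>facets K. insert v S \<subseteq> Z \<longrightarrow> Z \<in> \<U>}"
      have IH: "Z' \<in> \<U>" if "v \<notin> S" "Z \<in> \<U>" "insert v S \<subseteq> Z" "Z' \<in> facets K" "insert v S \<subseteq> Z'" for v Z Z'
      proof (rule Suc.hyps(1)[of "insert v S" Z])
        show "n = d + 1 - card (insert v S)" using Suc.hyps(2) that finS by simp
      qed (use that Suc.prems in auto)
      have "\<not> X \<subseteq> S" "\<not> Y \<subseteq> S"
        using XY 2 finS card_mono[of S X] card_mono[of S Y] by auto
      then obtain a c where a: "a \<in> X" "a \<notin> S" and c: "c \<in> Y" "c \<notin> S" by blast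
      have "c \<in> A"
      proof (rule connected_realization_vertex_induct[OF abstract_complex_link[OF manifold_complex]])
        show "connected (realization (link K S))"
          by (rule manifold_link_connected[OF SK 2])
        show "{a} \<in> link K S" "{c} \<in> link K S"
          using a c XY Suc.prems manifold_face_subset[of X "{a} \<union> S"] manifold_face_subset[of Y "{c} \<union> S"]
          by (auto simp: link_def)
        show "a \<in> A" unfolding A_def using IH[OF a(2) Suc.prems(1)] a Suc.prems by blast
        fix u v assume u: "u \<in> A" and "{u, v} \<in> link K S"
        then have v: "v \<notin> S" "{u, v} \<union> S \<in> K" by (auto simp: link_def)
        obtain Z where Z: "Z \<in> facets K" "{u, v} \<union> S \<subseteq> Z"
          using face_in_facet[OF manifold_complex v(2)] by blast
        then have "Z \<in> \<U>" using u by (auto simp: A_def)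
        then show "v \<in> A" unfolding A_def using IH[OF v(1), of Z] Z by blast
      qed
      then show ?thesis using Suc.prems c by (auto simp: A_def)
    qed
  qed
  from this[OF X Y] show ?thesis by simp
qed

text \<open>The faces that are new at step \<open>n\<close> are those all of whose facets come at step \<open>n\<close> or later.  The
  first condition on \<open>R\<close> says that each of them contains \<open>R\<close>; by the second condition and strong
  connectedness of its star, \<open>R\<close> itself is new.\<close>

lemma manifold_relative_shellingI:
  assumes hs: "distinct Hs" "set Hs = facets K \<inter> C"
    and R: "\<And>n. n < length Hs \<Longrightarrow> \<exists>R \<subseteq> Hs ! n.
      (\<forall>v\<in>R. \<exists>X\<in>facets K. Hs ! n - {v} \<subseteq> X \<and> X \<notin> set (drop n Hs)) \<and>
      (\<forall>X\<in>set (drop n Hs). R \<subseteq> X \<longrightarrow>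
        (\<forall>w\<in>X-R. \<forall>Y\<in>facets K. X - {w} \<subseteq> Y \<longrightarrow> Y \<in> set (drop n Hs)))"
  shows "relative_shelling K (complex_diff K C) Hs"
proof -
  let ?L = "complex_diff K C"
  have K: "finite (facets K)" "\<forall>S\<in>facets K. finite S" "facets K \<subseteq> K"
    using manifold_complex by (auto simp: abstract_complex_def facets_def)
  have L: "abstract_complex ?L"
    unfolding complex_diff_def using K by (intro abstract_complex_generated_complex) auto
  have LK: "?L \<subseteq> K"
    using K(3) manifold_face_subset by (auto simp: complex_diff_def generated_complex_def)
  have "X \<in> C" if "X \<in> facets K" "X \<notin> ?L" for X
    using that by (auto simp: complex_diff_def generated_complex_def)
  moreover have "X \<notin> ?L" if X: "X \<in> facets K" "X \<in> C" for X
  proof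
    assume "X \<in> ?L"
    then obtain Y where "Y \<in> facets K - C" "X \<subseteq> Y"
      by (auto simp: complex_diff_def generated_complex_def)
    with X K(3) show False by (auto simp: facets_def)
  qed
  ultimately have set: "set Hs = facets K - ?L" using hs(2) by blast
  have shell: "\<exists>!S.
        S \<in> {T. T \<subseteq> Hs ! n \<and> T \<notin> ?L \<and> (\<forall>j<n. \<not> T \<subseteq> Hs ! j)} \<and>
        (\<forall>S'\<in>{T. T \<subseteq> Hs ! n \<and> T \<notin> ?L \<and> (\<forall>j<n. \<not> T \<subseteq> Hs ! j)}. S' \<subseteq> S \<longrightarrow> S' = S)"
    if n: "n < length Hs" for n
  proof -
    let ?U = "set (drop n Hs)" and ?H = "Hs ! n"
    let ?N = "{T. T \<subseteq> ?H \<and> T \<notin> ?L \<and> (\<forall>j<n. \<not> T \<subseteq> Hs ! j)}"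
    have split: "set Hs = set (take n Hs) \<union> ?U" "set (take n Hs) \<inter> ?U = {}"
      by (metis append_take_drop_id set_append)
        (metis append_take_drop_id hs(1) distinct_append)
    have take: "X \<in> set (take n Hs) \<longleftrightarrow> (\<exists>j<n. X = Hs ! j)" for X
      using n by (auto simp: in_set_conv_nth)
    have HU: "?H \<in> ?U" using n by (metis Cons_nth_drop_Suc list.set_intros(1))
    have N: "T \<in> ?N \<longleftrightarrow> T \<subseteq> ?H \<and> (\<forall>X\<in>facets K. T \<subseteq> X \<longrightarrow> X \<in> ?U)" for T
    proof
      assume T: "T \<in> ?N"
      have "X \<in> ?U" if X: "X \<in> facets K" "T \<subseteq> X" for X
      proof -
        have "X \<in> C" using T X by (auto simp: complex_diff_def generated_complex_def)
        then have "X \<in> set Hs" using X hs by blast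
        moreover have "X \<notin> set (take n Hs)" using T X take by auto
        ultimately show ?thesis using split by blast
      qed
      with T show "T \<subseteq> ?H \<and> (\<forall>X\<in>facets K. T \<subseteq> X \<longrightarrow> X \<in> ?U)" by blast
    next
      assume T: "T \<subseteq> ?H \<and> (\<forall>X\<in>facets K. T \<subseteq> X \<longrightarrow> X \<in> ?U)"
      have "T \<notin> ?L"
      proof
        assume "T \<in> ?L"
        then obtain X where "X \<in> facets K" "X \<notin> C" "T \<subseteq> X"
          by (auto simp: complex_diff_def generated_complex_def)
        then show False using T split(1) hs(2) by blast
      qed
      moreover have "\<not> T \<subseteq> Hs ! j" if "j < n" for j
      proof
        assume "T \<subseteq> Hs ! j"
        moreover have "Hs ! j \<in> set (take n Hs)" using take that by blast
        ultimately show False using T split hs(2) by blast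
      qed
      ultimately show "T \<in> ?N" using T by blast
    qed
    obtain R where RH: "R \<subseteq> ?H"
      and R1: "\<forall>v\<in>R. \<exists>X\<in>facets K. ?H - {v} \<subseteq> X \<and> X \<notin> ?U"
      and R2: "\<forall>X\<in>?U. R \<subseteq> X \<longrightarrow> (\<forall>w\<in>X-R. \<forall>Y\<in>facets K. X - {w} \<subseteq> Y \<longrightarrow> Y \<in> ?U)"
      using R[OF n] by blast
    have U: "?U \<subseteq> facets K" using split(1) hs(2) by blast
    have "Y \<in> ?U" if "Y \<in> facets K" "R \<subseteq> Y" for Y
      by (rule manifold_star_induct[OF HU RH that U]) (use R2 in blast)
    with RH have RN: "R \<in> ?N" by (intro N[THEN iffD2]) simp
    \<comment> \<open>A face \<open>T\<close> missing \<open>v\<close> would lie in the ridge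
      opposite to \<open>v\<close>, hence in a facet outside \<open>?U\<close>. So \<open>R\<close>
      is even the least new face, which makes it the unique minimal one.\<close>
    have least: "R \<subseteq> T" if "T \<in> ?N" for T
    proof
      fix v assume v: "v \<in> R"
      show "v \<in> T"
      proof (rule ccontr)
        assume "v \<notin> T"
        moreover have T: "T \<subseteq> ?H" "\<And>X. X \<in> facets K \<Longrightarrow> T \<subseteq> X \<Longrightarrow> X \<in> ?U"
          using N[THEN iffD1, OF that] by simp_all
        moreover obtain X where "X \<in> facets K" "?H - {v} \<subseteq> X" "X \<notin> ?U"
          using R1 v by blast
        ultimately show False by blast
      qed
    qed
    show ?thesis
    proof (rule ex1I[of _ R])
      show "R \<in> ?N \<and> (\<forall>S'\<in>?N. S' \<subseteq> R \<longrightarrow> S' = R)"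
        using RN by (intro conjI ballI impI equalityI least)
      fix S assume S: "S \<in> ?N \<and> (\<forall>S'\<in>?N. S' \<subseteq> S \<longrightarrow> S' = S)"
      have "R = S" by (rule bspec[OF conjunct2[OF S] RN, THEN mp]) (rule least[OF conjunct1[OF S]])
      then show "S = R" by simp
    qed
  qed
  show ?thesis
    unfolding relative_shelling_def by (intro conjI allI impI manifold_complex L LK hs(1) set shell)
qed

end

section \<open>Facets of the diamond complexes\<close>

lemma complex_joinI: "A \<in> K \<Longrightarrow> B \<in> L \<Longrightarrow> A \<union> B \<in> complex_join K L"
  unfolding complex_join_def by blast

text \<open>Flattens the join: a set is a face of the new part iff it does not contain the
  subdivided face and, without the new vertex, spans a face together with it. If the subdivided face
  is absent, the second alternative is impossible, so no case distinction remains.\<close>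

lemma diamond_step_eq:
  assumes K: "\<forall>S\<in>K. \<forall>T. T \<subseteq> S \<longrightarrow> T \<in> K"
  shows "diamond_step d j K =
    {T. \<not> Old ` {j+1..d+1} \<subseteq> T \<and> (T \<in> K \<or> (T - {New j}) \<union> Old ` {j+1..d+1} \<in> K)}"
proof -
  define S where "S = Old ` {j+1..d+1}"
  define w where "w = New j"
  have w: "w \<notin> S" by (auto simp: S_def w_def)
  have "diamond_step d j K = {T. \<not> S \<subseteq> T \<and> (T \<in> K \<or> (T - {w}) \<union> S \<in> K)}"
  proof (cases "S \<in> K")
    case False
    then have "\<not> S \<subseteq> T" if "T \<in> K" for T using K that by blast
    moreover have "(T - {w}) \<union> S \<notin> K" for T using K False by blast
    ultimately show ?thesis using False by (auto simp: diamond_step_def S_def w_def)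
  next
    case True
    have "T \<in> complex_join {{}, {w}} (complex_join {T. T \<subset> S} (link K S)) \<longleftrightarrow>
      \<not> S \<subseteq> T \<and> (T - {w}) \<union> S \<in> K" for T
    proof
      assume "T \<in> complex_join {{}, {w}} (complex_join {T. T \<subset> S} (link K S))"
      then obtain W A L where T: "T = W \<union> (A \<union> L)" "W \<subseteq> {w}" "A \<subset> S" "L \<inter> S = {}" "L \<union> S \<in> K"
        by (auto simp: complex_join_def link_def)
      have "(T - {w}) \<union> S \<subseteq> L \<union> S" using T by blast
      then have "(T - {w}) \<union> S \<in> K" using K T by blast
      then show "\<not> S \<subseteq> T \<and> (T - {w}) \<union> S \<in> K" using T w by blast
    next
      assume T: "\<not> S \<subseteq> T \<and> (T - {w}) \<union> S \<in> K"
      have "(T - {w} - S) \<union> S = (T - {w}) \<union> S" by blast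
      then have "T - {w} - S \<in> link K S" using T by (auto simp: link_def)
      moreover have "T \<inter> S \<subset> S" using T by blast
      ultimately have "(T \<inter> S) \<union> (T - {w} - S) \<in> complex_join {T. T \<subset> S} (link K S)"
        by (intro complex_joinI) simp
      moreover have "T \<inter> {w} \<in> {{}, {w}}" by blast
      ultimately have "T \<inter> {w} \<union> ((T \<inter> S) \<union> (T - {w} - S))
          \<in> complex_join {{}, {w}} (complex_join {T. T \<subset> S} (link K S))"
        by (rule complex_joinI[rotated])
      moreover have "T \<inter> {w} \<union> ((T \<inter> S) \<union> (T - {w} - S)) = T" by blast
      ultimately show "T \<in> complex_join {{}, {w}} (complex_join {T. T \<subset> S} (link K S))"
        by simp
    qed
    then show ?thesis
      using True unfolding diamond_step_def stellar_subdivision_def S_def[symmetric] w_def[symmetric]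
      by auto
  qed
  then show ?thesis by (simp only: S_def w_def)
qed

lemma diamond_step_closed:
  assumes "\<forall>S\<in>K. \<forall>T. T \<subseteq> S \<longrightarrow> T \<in> K"
  shows "\<forall>S\<in>diamond_step d j K. \<forall>T. T \<subseteq> S \<longrightarrow> T \<in> diamond_step d j K"
proof (intro ballI allI impI)
  fix S T assume S: "S \<in> diamond_step d j K" and T: "T \<subseteq> S"
  have "(T - {New j}) \<union> Old ` {j+1..d+1} \<subseteq> (S - {New j}) \<union> Old ` {j+1..d+1}"
    using T by blast
  then show "T \<in> diamond_step d j K"
    using S T assms unfolding diamond_step_eq[OF assms] by blast
qed

text \<open>The membership condition of a step is monotone in the complex. This places the diamond
  of one facet inside the diamond of a complex generated by several.\<close>

lemma fold_diamond_step_mono: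
  assumes "\<forall>S\<in>K. \<forall>T. T \<subseteq> S \<longrightarrow> T \<in> K" "\<forall>S\<in>L. \<forall>T. T \<subseteq> S \<longrightarrow> T \<in> L" "K \<subseteq> L"
  shows "fold (diamond_step d) js K \<subseteq> fold (diamond_step d) js L"
  using assms
proof (induction js arbitrary: K L)
  case (Cons j js)
  have "diamond_step d j K \<subseteq> diamond_step d j L"
    using Cons.prems(3) unfolding diamond_step_eq[OF Cons.prems(1)] diamond_step_eq[OF Cons.prems(2)]
    by blast
  then show ?case
    using Cons.IH[OF diamond_step_closed[OF Cons.prems(1)] diamond_step_closed[OF Cons.prems(2)]] by simp
qed simp

lemma generated_complex_closed:
  "\<forall>S\<in>generated_complex A. \<forall>T. T \<subseteq> S \<longrightarrow> T \<in> generated_complex A"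
  unfolding generated_complex_def by blast

lemma diamond_facet_subset_diamond:
  assumes "j \<in> J"
  shows "diamond_facet d (i j) \<subseteq> diamond d (generated_complex ((\<lambda>j. simplex_facet d (i j)) ` J))"
  unfolding diamond_def
  by (rule fold_diamond_step_mono[OF generated_complex_closed generated_complex_closed])
    (use assms in \<open>auto simp: generated_complex_def\<close>)

text \<open>For \<open>m \<le> i\<close> the last condition is vacuous, since \<open>Old i \<notin> T\<close>: the steps before step \<open>i\<close> do
  nothing.\<close>

lemma fold_diamond_step_facet:
  assumes "i \<le> d + 1" "m \<le> d + 1"
  shows "fold (diamond_step d) [0..<m] (generated_complex {simplex_facet d i}) =
    {T. T \<subseteq> Old ` ({0..d+1} - {i}) \<union> New ` {i..<m} \<and> (\<forall>a. \<not> (Old a \<in> T \<and> New a \<in> T)) \<and>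
      \<not> Old ` {m..d+1} \<subseteq> T}" (is "_ = ?P m")
  using assms(2)
proof (induction m)
  case 0
  have "Old i \<in> Old ` {0..d+1}" "Old i \<notin> Old ` ({0..d+1} - {i}) \<union> New ` {i..<0}"
    using assms(1) by auto
  then show ?case by (auto simp: generated_complex_def simplex_facet_def)
next
  case (Suc m)
  define V where "V m = Old ` ({0..d+1} - {i}) \<union> New ` {i..<m}" for m
  define np where "np T \<longleftrightarrow> (\<forall>a. \<not> (Old a \<in> T \<and> New a \<in> T))" for T
  define S where "S = Old ` {m+1..d+1}"
  have "{m..d+1} = insert m {m+1..d+1}" using Suc.prems by auto
  then have ins: "Old ` {m..d+1} = insert (Old m) S"
    by (simp add: S_def)
  have P: "T \<in> ?P m \<longleftrightarrow> T \<subseteq> V m \<and> np T \<and> \<not> insert (Old m) S \<subseteq> T" for T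
    by (simp only: V_def np_def ins mem_Collect_eq)
  have np: "np S" if "np T" "S \<subseteq> T" for S T
    using that by (auto simp: np_def)
  have closed: "\<forall>S\<in>?P m. \<forall>T. T \<subseteq> S \<longrightarrow> T \<in> ?P m"
  proof (intro ballI allI impI)
    fix S T assume S: "S \<in> ?P m" and T: "T \<subseteq> S"
    then show "T \<in> ?P m" using np[OF _ T] unfolding P by auto
  qed
  have "T \<in> ?P (Suc m) \<longleftrightarrow> \<not> S \<subseteq> T \<and> (T \<in> ?P m \<or> (T - {New m}) \<union> S \<in> ?P m)" for T
  proof -
    have PS: "T \<in> ?P (Suc m) \<longleftrightarrow> T \<subseteq> V (Suc m) \<and> np T \<and> \<not> S \<subseteq> T"
      by (simp only: V_def np_def S_def mem_Collect_eq Suc_eq_plus1)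
    show ?thesis
    proof (cases "i \<le> m")
      case False
      then have "Old i \<in> S" using assms(1) by (auto simp: S_def)
      moreover have "Old i \<notin> V m" "V (Suc m) = V m" using False by (auto simp: V_def)
      ultimately show ?thesis unfolding PS P by auto
    next
      case True
      have V: "V (Suc m) = insert (New m) (V m)" "New m \<notin> V m" "S \<subseteq> V m"
        using True by (auto simp: V_def S_def)
      have m: "Old m \<notin> S" "New m \<notin> S" by (auto simp: S_def)
      \<comment> \<open>Positions beyond \<open>m\<close> have no new vertex yet, so adding
        \<open>S\<close> creates no pair \<open>Old a\<close>, \<open>New a\<close>.\<close>
      have N: "New a \<notin> V m" "New a \<notin> S" if "Old a \<in> S" for a
        using that by (auto simp: V_def S_def)
      have S: "New a \<notin> S" for a by (auto simp: S_def)
      have npS: "np ((T - {New m}) \<union> S) \<longleftrightarrow> np (T - {New m})" if "T - {New m} \<subseteq> V m"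
        using that N S by (auto simp: np_def)
      have D: "(T - {New m}) \<union> S \<in> ?P m \<longleftrightarrow>
          T - {New m} \<subseteq> V m \<and> np (T - {New m}) \<and> Old m \<notin> T"
        unfolding P using V(3) m npS by auto
      show ?thesis
      proof (cases "New m \<in> T")
        case True
        have "np T \<longleftrightarrow> np (T - {New m}) \<and> Old m \<notin> T"
          using True by (auto simp: np_def)
        then show ?thesis unfolding PS D using True V by (auto simp: P)
      next
        case False
        then have "T - {New m} = T" by simp
        then show ?thesis unfolding PS unfolding D unfolding P using False V by auto
      qed
    qed
  qed
  then have "?P (Suc m) = diamond_step d m (?P m)"
    unfolding diamond_step_eq[OF closed] S_def by (intro set_eqI) (simp only: mem_Collect_eq)
  moreover have "fold (diamond_step d) [0..<m] (generated_complex {simplex_facet d i}) = ?P m"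
    using Suc by simp
  ultimately show ?case by simp
qed

text \<open>After the last step the excluded face is the single vertex \<open>Old (d+1)\<close>,
  which therefore disappears. The sets without antipodal pairs remain.\<close>

lemma diamond_facet_eq:
  assumes "i \<le> d + 1"
  shows "diamond_facet d i =
    {T. T \<subseteq> Old ` ({0..d} - {i}) \<union> New ` {i..d} \<and> (\<forall>a. \<not> (Old a \<in> T \<and> New a \<in> T))}"
proof -
  have "Old ` ({0..d+1} - {i}) \<union> New ` {i..<d+1} =
      insert (Old (d+1)) (Old ` ({0..d} - {i})) \<union> New ` {i..d} - (if i = d + 1 then {Old (d+1)} else {})"
    by (auto simp: image_iff le_Suc_eq)
  moreover have "Old ` {d+1..d+1} = {Old (d+1)}" "Old (d+1) \<notin> Old ` ({0..d} - {i}) \<union> New ` {i..d}" by auto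
  ultimately show ?thesis
    unfolding diamond_def fold_diamond_step_facet[OF assms le_refl]
    by (auto split: if_splits)
qed

text \<open>A set \<open>A \<subseteq> {0..d}\<close> encodes the facet of the cross-polytope boundary that contains \<open>v\<^sub>j\<close> for
  \<open>j \<in> A\<close> and \<open>j\<close> for \<open>j \<notin> A\<close>.  Removing the vertex in position \<open>j\<close> gives a ridge, whose other facet
  is encoded by \<open>sym_diff A {j}\<close>.  The facets of \<open>\<Diamond>(\<Gamma>\<^sub>i)\<close> are the sets with least element \<open>i\<close>, and
  the empty set for \<open>i = d + 1\<close>.\<close>

definition cell :: "nat \<Rightarrow> nat set \<Rightarrow> dvertex set" where
  "cell d A = Old ` ({0..d} - A) \<union> New ` A"

definition cell_vertex :: "nat set \<Rightarrow> nat \<Rightarrow> dvertex" where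
  "cell_vertex A j = (if j \<in> A then New j else Old j)"

definition block :: "nat \<Rightarrow> nat \<Rightarrow> nat set set" where
  "block d i = {A. A \<subseteq> {i..d} \<and> (i \<le> d \<longrightarrow> i \<in> A)}"

lemma in_cell [simp]:
  "Old j \<in> cell d A \<longleftrightarrow> j \<le> d \<and> j \<notin> A" "New j \<in> cell d A \<longleftrightarrow> j \<in> A"
  by (auto simp: cell_def)

lemma cell_alt: "A \<subseteq> {0..d} \<Longrightarrow> cell d A = cell_vertex A ` {0..d}"
  by (auto simp: cell_def cell_vertex_def)

lemma cell_vertex_in_cell_iff:
  "j \<le> d \<Longrightarrow> cell_vertex A j \<in> cell d B \<longleftrightarrow> (j \<in> A \<longleftrightarrow> j \<in> B)"
  by (auto simp: cell_vertex_def)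

lemma inj_cell_vertex: "inj (cell_vertex A)"
  by (auto simp: inj_def cell_vertex_def split: if_splits)

lemma card_cell: "A \<subseteq> {0..d} \<Longrightarrow> finite (cell d A) \<and> card (cell d A) = d + 1"
  by (simp add: cell_alt card_image inj_on_subset[OF inj_cell_vertex])

lemma cell_ridge_subset:
  assumes "A \<subseteq> {0..d}" "B \<subseteq> {0..d}" "j \<le> d"
  shows "cell d A - {cell_vertex A j} \<subseteq> cell d B \<longleftrightarrow> B = A \<or> B = sym_diff A {j}"
proof -
  have "cell d A - {cell_vertex A j} = cell_vertex A ` ({0..d} - {j})"
    unfolding cell_alt[OF assms(1)] using inj_cell_vertex[of A] by (auto simp: inj_def)
  then have "cell d A - {cell_vertex A j} \<subseteq> cell d B \<longleftrightarrow> (\<forall>p\<in>{0..d} - {j}. p \<in> A \<longleftrightarrow> p \<in> B)"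
    using cell_vertex_in_cell_iff by auto
  also have "\<dots> \<longleftrightarrow> sym_diff A B \<subseteq> {j}"
    using assms by blast
  also have "\<dots> \<longleftrightarrow> B = A \<or> B = sym_diff A {j}"
    by blast
  finally show ?thesis .
qed

lemma cell_subset_iff:
  assumes "A \<subseteq> {0..d}" "B \<subseteq> {0..d}"
  shows "cell d A \<subseteq> cell d B \<longleftrightarrow> A = B"
proof
  assume "cell d A \<subseteq> cell d B"
  then have "j \<in> A \<longleftrightarrow> j \<in> B" if "j \<le> d" for j
    using cell_vertex_in_cell_iff[OF that, of A A] cell_vertex_in_cell_iff[OF that, of A B] by blast
  with assms show "A = B" by (meson atLeastAtMost_iff subsetD subset_antisym subsetI)
qed simp

lemma block_subset: "A \<in> block d i \<Longrightarrow> A \<subseteq> {0..d}"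
  by (auto simp: block_def)

text \<open>The index is the least element of the set, or \<open>d + 1\<close> for the empty set;
  every index above \<open>d\<close> gives the block \<open>{{}}\<close>, hence the bounds.\<close>

lemma block_unique:
  assumes "A \<in> block d i" "A \<in> block d i'" "i \<le> d + 1" "i' \<le> d + 1"
  shows "i = i'"
proof (rule ccontr)
  assume "i \<noteq> i'"
  then consider "i < i'" | "i' < i" by linarith
  then show False by cases (use assms in \<open>auto simp: block_def subset_iff\<close>)
qed

lemma facets_diamond_facet:
  assumes "i \<le> d + 1"
  shows "facets (diamond_facet d i) = cell d ` block d i"
proof -
  let ?D = "diamond_facet d i"
  have cell: "cell d A \<in> ?D" if "A \<in> block d i" for A
    using that unfolding diamond_facet_eq[OF assms] cell_def block_def by auto
  have ex: "\<exists>A\<in>block d i. T \<subseteq> cell d A" if "T \<in> ?D" for T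
  proof
    \<comment> \<open>Each position from \<open>i\<close> on not occupied by its old vertex gets the
      new one; \<open>i\<close> is among them, since \<open>Old i\<close> is not a vertex of the
      complex.\<close>
    let ?A = "{j\<in>{i..d}. Old j \<notin> T}"
    have T: "T \<subseteq> Old ` ({0..d} - {i}) \<union> New ` {i..d}" "\<And>a. Old a \<in> T \<Longrightarrow> New a \<notin> T"
      using that unfolding diamond_facet_eq[OF assms] by auto
    show "?A \<in> block d i" using T by (auto simp: block_def)
    show "T \<subseteq> cell d ?A"
    proof
      fix x assume "x \<in> T"
      then show "x \<in> cell d ?A" using T by (cases x) auto
    qed
  qed
  show ?thesis
  proof (intro equalityI subsetI)
    fix T assume T: "T \<in> facets ?D"
    then have "T \<in> ?D" by (simp add: facets_def)
    then obtain A where "A \<in> block d i" "T \<subseteq> cell d A" using ex[of T] by blast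
    with T cell show "T \<in> cell d ` block d i" by (auto simp: facets_def)
  next
    fix T assume "T \<in> cell d ` block d i"
    then obtain A where A: "A \<in> block d i" "T = cell d A" by auto
    have "S = T" if S: "S \<in> ?D" "T \<subseteq> S" for S
    proof -
      obtain B where B: "B \<in> block d i" "S \<subseteq> cell d B" using ex[OF S(1)] by blast
      have "A = B"
        using cell_subset_iff[OF block_subset[OF A(1)] block_subset[OF B(1)]] A(2) B(2) S(2) by blast
      then show ?thesis using A B S by simp
    qed
    with cell[OF A(1)] show "T \<in> facets ?D" unfolding facets_def A(2) by simp
  qed
qed

text \<open>Facets of the manifold are recognized by cardinality; this identifies those lying in the
  image as images of cells.\<close>

lemma diamond_facet_card:
  assumes "i \<le> d + 1" "T \<in> diamond_facet d i"
  shows "finite T" "card T = d + 1 \<Longrightarrow> T \<in> facets (diamond_facet d i)"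
proof -
  have fin: "finite (diamond_facet d i)"
    unfolding diamond_facet_eq[OF assms(1)] by simp
  show finT: "finite T"
    using assms unfolding diamond_facet_eq[OF assms(1)] by (auto intro: finite_subset)
  assume card: "card T = d + 1"
  obtain X where X: "X \<in> facets (diamond_facet d i)" "T \<subseteq> X"
  proof -
    have "T \<in> {X \<in> diamond_facet d i. T \<subseteq> X}" using assms by simp
    then obtain X where "X \<in> {X \<in> diamond_facet d i. T \<subseteq> X}"
      "\<forall>Y\<in>{X \<in> diamond_facet d i. T \<subseteq> X}. X \<subseteq> Y \<longrightarrow> X = Y"
      using finite_has_maximal[of "{X \<in> diamond_facet d i. T \<subseteq> X}"] fin by fastforce
    then show ?thesis by (intro that[of X]) (auto simp: facets_def)
  qed
  then obtain A where "A \<in> block d i" "X = cell d A" using facets_diamond_facet[OF assms(1)] by auto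
  then have "finite X" "card X = d + 1" using card_cell block_subset by auto
  with X card have "T = X" by (metis card_subset_eq)
  with X show "T \<in> facets (diamond_facet d i)" by simp
qed

lemma dl_phi_cell:
  "j \<le> d \<Longrightarrow> dl_phi (cell d E) (cell d A) j = (if j \<in> sym_diff A E then 1 else 0)"
  by (auto simp: dl_phi_def)

lemma dl_deg_cell: "dl_deg d i (cell d E) (cell d A) = card (sym_diff A E \<inter> {i<..d})"
proof -
  have "dl_deg d i (cell d E) (cell d A) = (\<Sum>j\<in>{i+1..d}. if j \<in> sym_diff A E then 1 else 0)"
    unfolding dl_deg_def by (rule sum.cong) (auto simp: dl_phi_cell)
  also have "\<dots> = card ({i+1..d} \<inter> {j. j \<in> sym_diff A E})"
    by (subst sum.If_cases) auto
  also have "{i+1..d} \<inter> {j. j \<in> sym_diff A E} = sym_diff A E \<inter> {i<..d}"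
    by auto
  finally show ?thesis .
qed

lemma deglex_less_asym:
  assumes "deglex_less d i F H H'" shows "\<not> deglex_less d i F H' H"
proof
  assume "deglex_less d i F H' H"
  with assms obtain t t' where
    t: "t \<in> {i+1..d}" "\<forall>s\<in>{i+1..<t}. dl_phi F H s = dl_phi F H' s" "dl_phi F H t = 0" "dl_phi F H' t = 1"
    and t': "t' \<in> {i+1..d}" "\<forall>s\<in>{i+1..<t'}. dl_phi F H' s = dl_phi F H s" "dl_phi F H' t' = 0" "dl_phi F H t' = 1"
    unfolding deglex_less_def by fastforce
  consider "t < t'" | "t = t'" | "t' < t" by linarith
  then show False by cases (use t t' in auto)
qed

section \<open>The order of the facets\<close>

text \<open>\<open>A'\<close> lies in the subcube through \<open>A\<close> whose directions \<open>j\<close> are those in which the neighbour of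
  \<open>A\<close> comes earlier in the order \<open>lt\<close>.  Such a \<open>j\<close> is either smaller than \<open>i l\<close> and the index of an
  earlier block, or a position above \<open>i l\<close> where \<open>A\<close> differs from \<open>E l\<close>, or equal to \<open>i l\<close>.  The
  last case needs the neighbour to be in block \<open>i 1\<close>, and then the choice of \<open>E l\<close> keeps \<open>i 1\<close>
  the least element above \<open>i l\<close> throughout the subcube.\<close>

lemma block_flip_induct:
  fixes i :: "nat \<Rightarrow> nat" and lt :: "nat set \<Rightarrow> nat set \<Rightarrow> bool" and E :: "nat \<Rightarrow> nat set"
  assumes i: "\<And>l. l \<in> {1..k} \<Longrightarrow> i l \<le> d + 1" and mono: "strict_mono_on {2..k} i"
    and lt_index: "\<And>l l' A A'. l \<in> {1..k} \<Longrightarrow> l' \<in> {1..k} \<Longrightarrow> l < l' \<Longrightarrow>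
      A \<in> block d (i l) \<Longrightarrow> A' \<in> block d (i l') \<Longrightarrow> lt A A'"
    and lt_deg: "\<And>l A A'. l \<in> {1..k} \<Longrightarrow> A \<in> block d (i l) \<Longrightarrow> A' \<in> block d (i l) \<Longrightarrow>
      card (sym_diff A (E l) \<inter> {i l<..d}) < card (sym_diff A' (E l) \<inter> {i l<..d}) \<Longrightarrow> lt A A'"
    and asym: "\<And>A A'. lt A A' \<Longrightarrow> \<not> lt A' A"
    and E: "\<And>l. l \<in> {2..k} \<Longrightarrow> i l < i 1 \<Longrightarrow> E l \<inter> {i l<..d} = {i 1..d}"
    and l: "l \<in> {1..k}" and A: "A \<in> block d (i l)"
    and A': "\<And>j. j \<in> sym_diff A A' \<Longrightarrow> j \<le> d \<and>
      sym_diff A {j} \<in> (\<Union>l\<in>{1..k}. block d (i l)) \<and> lt (sym_diff A {j}) A"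
  shows "A' = A \<or> A' \<in> (\<Union>l\<in>{1..k}. block d (i l)) \<and> lt A' A"
proof -
  define a where "a = i l"
  define S where "S = sym_diff A (E l) \<inter> {a<..d}"
  have Aa: "A \<subseteq> {a..d}" "a \<le> d \<Longrightarrow> a \<in> A" using A by (auto simp: block_def a_def)
  have A'd: "j \<le> d" if "j \<in> A'" for j
    using that A' Aa(1) by (metis DiffI UnI2 atLeastAtMost_iff in_mono)
  \<comment> \<open>A flip that leaves the block can only precede \<open>A\<close> by landing in a
    block of smaller position in the sequence.\<close>
  have earlier: "\<exists>l'\<in>{1..<l}. i l' = b"
    if B: "sym_diff A {j} \<in> block d b" "b \<noteq> a" "b \<le> d + 1" and j: "j \<in> sym_diff A A'" for b j
  proof -
    obtain l' where l': "l' \<in> {1..k}" "sym_diff A {j} \<in> block d (i l')"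
      using A'[OF j] by blast
    then have b: "i l' = b" using block_unique[OF l'(2) B(1) i[OF l'(1)] B(3)] by simp
    have "\<not> l < l'" using lt_index[OF l l'(1) _ A l'(2)] A'[OF j] asym by blast
    with b B(2) l' show ?thesis by (metis a_def atLeastAtMost_iff atLeastLessThan_iff linorder_neqE_nat)
  qed
  \<comment> \<open>Flipping a position above \<open>a\<close> where \<open>A\<close> agrees with
    \<open>E l\<close> would raise the degree and come later, so such flips only go towards
    \<open>E l\<close>.\<close>
  have above: "j \<in> S" if j: "j \<in> sym_diff A A'" "a < j" for j
  proof (rule ccontr)
    assume nS: "j \<notin> S"
    have jd: "j \<le> d" using A'[OF j(1)] by blast
    have "a \<in> A" using Aa jd j by simp
    then have B: "sym_diff A {j} \<in> block d (i l)"
      using Aa jd j by (auto simp: block_def a_def[symmetric])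
    have "sym_diff (sym_diff A {j}) (E l) \<inter> {i l<..d} = insert j S"
      using nS jd j(2) unfolding S_def a_def[symmetric] by auto
    moreover have "card S < card (insert j S)" using nS by (simp add: S_def)
    ultimately have "lt A (sym_diff A {j})"
      using lt_deg[OF l A B] by (simp add: S_def a_def)
    then show False using asym A'[OF j(1)] by blast
  qed
  show ?thesis
  proof (cases "\<exists>j\<in>A'. j < a")
    case True
    \<comment> \<open>The least element of \<open>A'\<close> is itself an allowed flip of
      \<open>A\<close>. It is thus the index of an earlier block, and that block contains
      \<open>A'\<close>.\<close>
    define m where "m = (LEAST j. j \<in> A')"
    have m: "m \<in> A'" "m < a" "\<And>j. j \<in> A' \<Longrightarrow> m \<le> j"
      using True LeastI[of "\<lambda>j. j \<in> A'"] Least_le[of "\<lambda>j. j \<in> A'"]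
      unfolding m_def by (auto intro: le_less_trans)
    have mA: "m \<notin> A" using m(2) Aa(1) by auto
    have jm: "m \<in> sym_diff A A'" using m(1) mA by blast
    have md: "m \<le> d" using A'd m(1) by blast
    have Bm: "sym_diff A {m} \<in> block d m"
      using Aa(1) mA m(2) md by (auto simp: block_def)
    obtain l' where l': "l' \<in> {1..<l}" "i l' = m"
      using earlier[OF Bm _ _ jm] m(2) md by auto
    moreover have "A' \<in> block d m" using m A'd by (auto simp: block_def)
    ultimately show ?thesis using lt_index[of l' l A' A] A l by auto
  next
    case False
    then have A'a: "A' \<subseteq> {a..d}" using A'd by (auto simp: not_less)
    show ?thesis
    proof (cases "a \<le> d \<and> a \<notin> A'")
      case True
      then have ja: "a \<in> sym_diff A A'" using Aa by blast
      have "a \<in> A" using True Aa by blast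
      obtain l' where l': "l' \<in> {1..k}" "sym_diff A {a} \<in> block d (i l')"
        using A'[OF ja] by blast
      have "sym_diff A {a} \<subseteq> {a<..d}" using Aa \<open>a \<in> A\<close> by force
      then have gt: "a < i l'"
        using l'(2) True i l'(1) by (cases "i l' \<le> d") (auto simp: block_def)
      then obtain l'' where l'': "l'' \<in> {1..<l}" "i l'' = i l'"
        using earlier[OF l'(2) _ _ ja] i l'(1) by force
      \<comment> \<open>Removing \<open>a\<close> leads to a block of larger index earlier in the
        sequence. As the indices from position 2 on increase, this is block
        \<open>i 1\<close>.\<close>
      have "l'' = 1"
      proof (rule ccontr)
        assume "l'' \<noteq> 1"
        then have "i l'' < i l"
          using l'' l by (intro strict_mono_onD[OF mono]) auto
        then show False using gt l''(2) by (simp add: a_def)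
      qed
      with l'' gt l have i1: "a < i 1" "l \<in> {2..k}" "1 < l" and
        Ab: "sym_diff A {a} \<in> block d (i 1)"
        using l'(2) by auto
      have El: "j \<in> E l \<longleftrightarrow> i 1 \<le> j" if "a < j" "j \<le> d" for j
        using E[OF i1(2)] i1(1) that unfolding a_def[symmetric] by auto
      have A1: "j \<in> A \<Longrightarrow> j = a \<or> i 1 \<le> j" for j
        using Ab by (auto simp: block_def)
      \<comment> \<open>Strictly between \<open>a\<close> and \<open>i 1\<close> both
        \<open>A\<close> and \<open>E l\<close> have no element, and both contain \<open>i 1\<close>
        when it is at most \<open>d\<close>. By \<open>above\<close>, none of these positions can
        flip, so \<open>A'\<close> has least element \<open>i 1\<close>, or is empty when
        \<open>i 1 = d + 1\<close>.\<close>
      have "i 1 \<le> j" if "j \<in> A'" for j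
      proof (rule ccontr)
        assume j: "\<not> i 1 \<le> j"
        have ja: "a < j" "j \<le> d" using that True A'a by (auto simp: less_le)
        then have "j \<notin> A" using A1 j by auto
        then have "j \<in> S" using that above[of j] ja by blast
        then show False using \<open>j \<notin> A\<close> El[OF ja] j by (simp add: S_def)
      qed
      moreover have "i 1 \<in> A'" if "i 1 \<le> d"
      proof (rule ccontr)
        assume "i 1 \<notin> A'"
        have "i 1 \<in> A" using Ab that i1(1) by (auto simp: block_def)
        then have "i 1 \<in> S" using above[of "i 1"] i1(1) \<open>i 1 \<notin> A'\<close> by blast
        then show False using \<open>i 1 \<in> A\<close> El[OF i1(1) that] by (simp add: S_def)
      qed
      ultimately have "A' \<in> block d (i 1)"
        using A'd by (auto simp: block_def)
      then show ?thesis using lt_index[of 1 l A' A] A l i1(3) by auto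
    next
      case False
      then have A'b: "A' \<in> block d (i l)" using A'a by (auto simp: block_def a_def[symmetric])
      \<comment> \<open>In the same block all flips go towards \<open>E l\<close>, so together they
        lower the degree by their number.\<close>
      have sub: "sym_diff A A' \<subseteq> S"
      proof
        fix j assume j: "j \<in> sym_diff A A'"
        then have "a \<le> j" "j \<le> d" using Aa(1) A'a by auto
        moreover have "j \<noteq> a" using j False Aa calculation by auto
        ultimately show "j \<in> S" using above[OF j] by simp
      qed
      have "sym_diff A' (E l) \<inter> {a<..d} = S - sym_diff A A'"
        using sub unfolding S_def by blast
      show ?thesis
      proof (cases "A' = A")
        case False
        then have "S - sym_diff A A' \<subset> S" using sub by blast
        then have "card (S - sym_diff A A') < card S"
          by (intro psubset_card_mono) (simp_all add: S_def)
        then have "lt A' A"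
          using lt_deg[OF l A'b A] \<open>_ = S - sym_diff A A'\<close> by (simp add: S_def a_def)
        then show ?thesis using A'b l by blast
      qed simp
    qed
  qed
qed

text \<open>Sortedness puts each later element \<open>P\<close>-below \<open>xs ! n\<close>, and
  asymmetry keeps the earlier ones out. Tails of the list thus become a condition on the
  order.\<close>

lemma set_drop_sorted_wrt:
  assumes "sorted_wrt (\<lambda>x y. P y x) xs" and n: "n < length xs"
    and asym: "\<And>x y. P x y \<Longrightarrow> \<not> P y x"
  shows "set (drop n xs) = insert (xs ! n) {x \<in> set xs. P x (xs ! n)}"
proof -
  have P: "P (xs ! q) (xs ! p)" if "p < q" "q < length xs" for p q
    using sorted_wrt_nth_less[OF assms(1) that] .
  have nP: "\<not> P x x" for x using asym by blast
  have drop: "x \<in> set (drop n xs) \<longleftrightarrow> (\<exists>q. n \<le> q \<and> q < length xs \<and> x = xs ! q)" for x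
  proof
    assume "x \<in> set (drop n xs)"
    then obtain q where "q < length xs - n" "x = xs ! (n + q)"
      by (auto simp: in_set_conv_nth)
    then show "\<exists>q. n \<le> q \<and> q < length xs \<and> x = xs ! q" by (intro exI[of _ "n + q"]) auto
  next
    assume "\<exists>q. n \<le> q \<and> q < length xs \<and> x = xs ! q"
    then obtain q where q: "n \<le> q" "q < length xs" "x = xs ! q" by blast
    then have "drop n xs ! (q - n) = x" "q - n < length (drop n xs)" by simp_all
    then show "x \<in> set (drop n xs)" by (metis nth_mem)
  qed
  have le: "n \<le> q" if "q < length xs" "P (xs ! q) (xs ! n)" for q
  proof (rule ccontr)
    assume "\<not> n \<le> q"
    with P[of q n] n that(2) asym show False by auto
  qed
  show ?thesis
  proof (intro set_eqI iffI)
    fix x assume "x \<in> set (drop n xs)"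
    then obtain q where "n \<le> q" "q < length xs" "x = xs ! q" using drop by blast
    then show "x \<in> insert (xs ! n) {x \<in> set xs. P x (xs ! n)}"
      using P[of n q] by (cases "n = q") auto
  next
    fix x assume "x \<in> insert (xs ! n) {x \<in> set xs. P x (xs ! n)}"
    then show "x \<in> set (drop n xs)" using drop n le by (auto simp: in_set_conv_nth)
  qed
qed

lemma sorted_wrt_concat_map:
  assumes "\<And>l. l \<in> set ls \<Longrightarrow> sorted_wrt P (xs l)" "sorted_wrt R ls"
    and "\<And>l l' x y. l \<in> set ls \<Longrightarrow> l' \<in> set ls \<Longrightarrow> R l l' \<Longrightarrow> x \<in> set (xs l) \<Longrightarrow> y \<in> set (xs l') \<Longrightarrow> P x y"
  shows "sorted_wrt P (concat (map xs ls))"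
  using assms
proof (induction ls)
  case (Cons a ls)
  have "sorted_wrt P (concat (map xs ls))"
  proof (rule Cons.IH)
    show "P x y" if "l \<in> set ls" "l' \<in> set ls" "R l l'" "x \<in> set (xs l)" "y \<in> set (xs l')" for l l' x y
      using that by (intro Cons.prems(3)[of l l']) auto
  qed (use Cons.prems in auto)
  moreover have "P x y" if "x \<in> set (xs a)" "l \<in> set ls" "y \<in> set (xs l)" for x y l
    using that Cons.prems(2) by (intro Cons.prems(3)[of a l]) auto
  ultimately show ?case using Cons.prems(1) by (auto simp: sorted_wrt_append)
qed simp

lemma distinct_concat_map:
  assumes "\<And>l. l \<in> set ls \<Longrightarrow> distinct (xs l)" "distinct ls"
    and "\<And>l l'. l \<in> set ls \<Longrightarrow> l' \<in> set ls \<Longrightarrow> l \<noteq> l' \<Longrightarrow> set (xs l) \<inter> set (xs l') = {}"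
  shows "distinct (concat (map xs ls))"
  using assms by (induction ls) (simp, fastforce)

text \<open>The encoding is \<open>i l\<close> together with all positions from
  \<open>next_index i l\<close> on. None of \<open>i 2\<close>, ..., \<open>i l\<close> exceeds
  \<open>i l\<close>, so if \<open>i 1\<close> does, it is the next index.\<close>

lemma initial_facet_cell:
  assumes i: "\<And>l. l \<in> {1..k} \<Longrightarrow> i l \<le> d + 1" and mono: "strict_mono_on {2..k} i"
    and l: "l \<in> {2..k}"
  shows "\<exists>E. initial_facet d i G l = cell d E \<and> (i l < i 1 \<longrightarrow> E \<inter> {i l<..d} = {i 1..d})"
proof -
  have l1: "l \<noteq> 1" "i l \<le> d + 1" using l i by auto
  show ?thesis
  proof (cases "i l = d + 1")
    case True
    have "i 1 \<le> d + 1" using i l by auto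
    moreover have "initial_facet d i G l = cell d {}"
      using True l1 by (simp add: initial_facet_def cell_def)
    ultimately show ?thesis using True by auto
  next
    case False
    let ?p = "next_index i l"
    have p: "i l \<le> ?p" "?p \<le> d + 1" "i l < i 1 \<longrightarrow> ?p = i 1"
    proof -
      let ?M = "{i j | j. j \<in> {1..l} \<and> i j > i l}"
      have fin: "finite ?M" by simp
      have M: "?M \<subseteq> {i l<..d+1}" using i l by auto
      show "i l \<le> ?p" "?p \<le> d + 1"
      proof -
        have "?p \<in> ?M" if ex: "\<exists>j\<in>{1..l}. i j > i l"
        proof -
          have "?M \<noteq> {}" using ex by blast
          from Min_in[OF fin this] show ?thesis using ex by (simp only: next_index_def if_True)
        qed
        moreover have "?p = i l" if "\<not> (\<exists>j\<in>{1..l}. i j > i l)"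
          using that by (simp only: next_index_def if_False)
        ultimately have "?p \<in> insert (i l) ?M" by blast
        then have "?p \<in> insert (i l) {i l<..d+1}" using M by blast
        then show "i l \<le> ?p" "?p \<le> d + 1" using l1 by auto
      qed
      show "i l < i 1 \<longrightarrow> ?p = i 1"
      proof
        assume gt: "i l < i 1"
        have le: "i j \<le> i l" if "j \<in> {2..l}" for j
        proof (cases "j = l")
          case False
          then have "i j < i l" using that l by (intro strict_mono_onD[OF mono]) auto
          then show ?thesis by simp
        qed simp
        have one: "j = 1" if "j \<in> {1..l}" "i l < i j" for j
        proof (rule ccontr)
          assume "j \<noteq> 1"
          with that(1) have "j \<in> {2..l}" by simp
          from le[OF this] that(2) show False by linarith
        qed
        have ex: "\<exists>j\<in>{1..l}. i j > i l" using gt l by (intro bexI[of _ 1]) auto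
        have "?M = {i 1}"
        proof (intro set_eqI iffI)
          fix x assume "x \<in> ?M"
          then obtain j where "x = i j" "j \<in> {1..l}" "i l < i j" by blast
          with one[of j] show "x \<in> {i 1}" by simp
        next
          fix x assume "x \<in> {i 1}"
          moreover have "1 \<in> {1..l}" using l by simp
          ultimately show "x \<in> ?M" using gt by blast
        qed
        then show "?p = i 1" using ex by (simp only: next_index_def if_True Min_singleton)
      qed
    qed
    define E where "E = insert (i l) {?p..d}"
    have diff: "{0..d} - E = {0..<i l} \<union> {i l + 1..<?p}"
      using p l1 False by (auto simp: E_def)
    have "initial_facet d i G l =
        Old ` {0..<i l} \<union> {New (i l)} \<union> Old ` {i l + 1..<?p} \<union> New ` {?p..d}"
      using l1 False by (simp add: initial_facet_def)
    also have "\<dots> = cell d E"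
      unfolding cell_def diff unfolding E_def by blast
    finally have "initial_facet d i G l = cell d E" .
    moreover have "i l < i 1 \<longrightarrow> E \<inter> {i l<..d} = {i 1..d}"
      using p(3) by (auto simp: E_def)
    ultimately show ?thesis by blast
  qed
qed

theorem theorem3p20:
  fixes \<Delta> :: "'v set set" and \<iota> :: "dvertex \<Rightarrow> 'v"
    and d k :: nat and i :: "nat \<Rightarrow> nat"
    and \<Gamma> :: "dvertex set set" and F G :: "dvertex set"
    and Fs :: "nat \<Rightarrow> dvertex set list"
  assumes "combinatorial_manifold_with_boundary d \<Delta>" and "balanced d \<Delta>"
    and "1 \<le> k" and "i ` {1..k} \<subseteq> {0..d+1}" and "inj_on i {1..k}"
    and "strict_mono_on {2..k} i"
    and "\<Gamma> = generated_complex ((\<lambda>j. simplex_facet d (i j)) ` {1..k})"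
    and "inj_on \<iota> (\<Union>(diamond d \<Gamma>))"
    and "induced_subcomplex (complex_image \<iota> (diamond d \<Gamma>)) \<Delta>"
    and "F \<in> diamond_facet d (i 1)" and "card F = d"
    and "complex_image \<iota> (diamond d \<Gamma>) \<inter> manifold_boundary d \<Delta> = Pow (\<iota> ` F)"
    and "G \<in> facets (diamond_facet d (i 1))" and "F \<subseteq> G"
    and "\<forall>l\<in>{1..k}. distinct (Fs l) \<and> set (Fs l) = facets (diamond_facet d (i l)) \<and>
           sorted_wrt (deglex_less d (i l) (initial_facet d i G l)) (Fs l)"
  shows "relative_shelling \<Delta>
           (complex_diff \<Delta> (\<Union>j\<in>{1..k}. complex_image \<iota> (diamond_facet d (i j))))
           (map (\<lambda>H. \<iota> ` H) (concat (map (\<lambda>l. rev (Fs l)) (rev [1..<k+1]))))"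
proof -

  \<comment> \<open>Encoding of the facets and their order\<close>
  note manifold = assms(1)
  define D where "D = diamond d \<Gamma>"
  define U where "U = (\<Union>l\<in>{1..k}. block d (i l))"
  define xs where "xs = concat (map (\<lambda>l. rev (Fs l)) (rev [1..<k+1]))"
  \<comment> \<open>Runs outwards from \<open>G\<close>, opposite to the list, in which the blocks
    and the facets inside each block are reversed.\<close>
  define before where "before X Y \<longleftrightarrow> (\<exists>l\<in>{1..k}. \<exists>l'\<in>{1..k}. X \<in> set (Fs l) \<and> Y \<in> set (Fs l') \<and>
    (l < l' \<or> l = l' \<and> deglex_less d (i l) (initial_facet d i G l) X Y))" for X Y
  have beforeI: "before X Y" if "l \<in> {1..k}" "l' \<in> {1..k}" "X \<in> set (Fs l)" "Y \<in> set (Fs l')"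
    "l < l' \<or> l = l' \<and> deglex_less d (i l) (initial_facet d i G l) X Y" for l l' X Y
    unfolding before_def using that by blast
  have i: "i l \<le> d + 1" if "l \<in> {1..k}" for l using subsetD[OF assms(4) imageI[OF that]] by simp
  have one: "1 \<in> {1..k}" using assms(3) by simp
  have Fs: "distinct (Fs l)" "set (Fs l) = cell d ` block d (i l)"
    "sorted_wrt (deglex_less d (i l) (initial_facet d i G l)) (Fs l)" if "l \<in> {1..k}" for l
    using assms(15) that facets_diamond_facet[OF i[OF that]] by auto
  have U: "A \<subseteq> {0..d}" if "A \<in> U" for A
    using that block_subset by (auto simp: U_def)
  have cell_inj: "A = B" if "cell d A = cell d B" "A \<subseteq> {0..d}" "B \<subseteq> {0..d}" for A B
    using cell_subset_iff[OF that(2,3)] that(1) by simp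
  have cell_Fs: "cell d A \<in> set (Fs l) \<longleftrightarrow> A \<in> block d (i l)" if "l \<in> {1..k}" "A \<subseteq> {0..d}" for l A
    using Fs(2)[OF that(1)] cell_inj[OF _ that(2) block_subset] by auto
  have Fs_unique: "l = l'" if l: "l \<in> {1..k}" "l' \<in> {1..k}" and X: "X \<in> set (Fs l)" "X \<in> set (Fs l')" for l l' X
  proof -
    obtain A where A: "X = cell d A" "A \<in> block d (i l)" using X(1) unfolding Fs(2)[OF l(1)] by blast
    then have "A \<in> block d (i l')" using cell_Fs[OF l(2) block_subset[OF A(2)]] X(2) by simp
    then have "i l = i l'" by (rule block_unique[OF A(2) _ i[OF l(1)] i[OF l(2)]])
    then show ?thesis using l by (rule inj_onD[OF assms(5)])
  qed

  \<comment> \<open>The reversed list of facets\<close>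
  have ls: "set (rev [1..<k+1]) = {1..k}" by auto
  have set_xs: "set xs = cell d ` U"
  proof -
    have "set xs = (\<Union>l\<in>set (rev [1..<k+1]). set (rev (Fs l)))"
      by (simp only: xs_def set_concat set_map image_image)
    then have "set xs = (\<Union>l\<in>{1..k}. set (Fs l))" unfolding ls by simp
    also have "\<dots> = (\<Union>l\<in>{1..k}. cell d ` block d (i l))" using Fs(2) by (intro SUP_cong) auto
    finally show ?thesis unfolding U_def image_UN .
  qed
  have xs_distinct: "distinct xs"
    unfolding xs_def
  proof (rule distinct_concat_map)
    show "set (rev (Fs l)) \<inter> set (rev (Fs l')) = {}"
      if "l \<in> set (rev [1..<k+1])" "l' \<in> set (rev [1..<k+1])" "l \<noteq> l'" for l l'
      using Fs_unique[of l l'] that unfolding ls by auto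
    show "distinct (rev (Fs l))" if "l \<in> set (rev [1..<k+1])" for l
      using Fs(1)[of l] that unfolding ls by simp
    show "distinct (rev [1..<k+1])" by (simp only: distinct_rev distinct_upt)
  qed
  have xs_sorted: "sorted_wrt (\<lambda>X Y. before Y X) xs"
    unfolding xs_def
  proof (rule sorted_wrt_concat_map[where R = "(>)"])
    show "sorted_wrt (\<lambda>X Y. before Y X) (rev (Fs l))" if "l \<in> set (rev [1..<k+1])" for l
    proof -
      have l: "l \<in> {1..k}" using that unfolding ls .
      show ?thesis unfolding sorted_wrt_rev
        by (rule sorted_wrt_mono_rel[OF _ Fs(3)[OF l]]) (use l in \<open>blast intro: beforeI\<close>)
    qed
    show "sorted_wrt (>) (rev [1..<k+1])"
      unfolding sorted_wrt_rev by (rule sorted_wrt_upt)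
    show "before Y X" if "l \<in> set (rev [1..<k+1])" "l' \<in> set (rev [1..<k+1])" "l > l'"
      "X \<in> set (rev (Fs l))" "Y \<in> set (rev (Fs l'))" for l l' X Y
    proof -
      have "l \<in> {1..k}" "l' \<in> {1..k}" using that(1,2) unfolding ls .
      then show ?thesis using that(3-5) by (intro beforeI[of l' l]) simp_all
    qed
  qed
  have asym: "\<not> before Y X" if XY: "before X Y" for X Y
  proof
    assume "before Y X"
    then obtain m m' where m: "m \<in> {1..k}" "m' \<in> {1..k}" "Y \<in> set (Fs m)" "X \<in> set (Fs m')"
      "m < m' \<or> m = m' \<and> deglex_less d (i m) (initial_facet d i G m) Y X"
      unfolding before_def by blast
    obtain l l' where l: "l \<in> {1..k}" "l' \<in> {1..k}" "X \<in> set (Fs l)" "Y \<in> set (Fs l')"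
      "l < l' \<or> l = l' \<and> deglex_less d (i l) (initial_facet d i G l) X Y"
      using XY unfolding before_def by blast
    have "l = m'" "l' = m" using Fs_unique l m by blast+
    with l(5) m(5) show False using deglex_less_asym by auto
  qed
  have drop_iff: "X \<in> set (drop n xs) \<longleftrightarrow> X = xs ! n \<or> X \<in> set xs \<and> before X (xs ! n)"
    if "n < length xs" for n X
    using set_drop_sorted_wrt[of before, OF xs_sorted that asym] by simp

  \<comment> \<open>Subcubes of earlier facets\<close>
  have "\<exists>E. initial_facet d i G l = cell d E \<and> (2 \<le> l \<longrightarrow> i l < i 1 \<longrightarrow> E \<inter> {i l<..d} = {i 1..d})"
    if l: "l \<in> {1..k}" for l
  proof (cases "l = 1")
    case True
    obtain A where "G = cell d A" using assms(13) facets_diamond_facet[OF i[OF one]] by auto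
    with True show ?thesis by (auto simp: initial_facet_def)
  next
    case False
    then have "l \<in> {2..k}" using l by auto
    from initial_facet_cell[OF i assms(6) this] show ?thesis by blast
  qed
  then obtain E where E: "initial_facet d i G l = cell d (E l)"
    "2 \<le> l \<longrightarrow> i l < i 1 \<longrightarrow> E l \<inter> {i l<..d} = {i 1..d}" if "l \<in> {1..k}" for l
    by metis
  have flip: "B = A \<or> B \<in> U \<and> before (cell d B) (cell d A)"
    if A: "A \<in> U" and B: "\<And>j. j \<in> sym_diff A B \<Longrightarrow> j \<le> d \<and> sym_diff A {j} \<in> U \<and>
      before (cell d (sym_diff A {j})) (cell d A)" for A B
  proof -
    obtain l where l: "l \<in> {1..k}" "A \<in> block d (i l)" using A by (auto simp: U_def)
    show ?thesis unfolding U_def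
    proof (rule block_flip_induct[where lt = "\<lambda>A B. before (cell d A) (cell d B)" and E = E, OF i assms(6)])
      show "before (cell d A) (cell d A')"
        if "l \<in> {1..k}" "l' \<in> {1..k}" "l < l'" "A \<in> block d (i l)" "A' \<in> block d (i l')" for l l' A A'
        using that cell_Fs block_subset by (intro beforeI[of l l']) blast+
      show "before (cell d A) (cell d A')"
        if "l \<in> {1..k}" "A \<in> block d (i l)" "A' \<in> block d (i l)"
          "card (sym_diff A (E l) \<inter> {i l<..d}) < card (sym_diff A' (E l) \<inter> {i l<..d})" for l A A'
      proof -
        have "deglex_less d (i l) (initial_facet d i G l) (cell d A) (cell d A')"
          using that(4) unfolding E(1)[OF that(1)] deglex_less_def dl_deg_cell by simp
        then show ?thesis using that(1-3) cell_Fs block_subset by (intro beforeI[of l l]) blast+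
      qed
      show "E l \<inter> {i l<..d} = {i 1..d}" if "l \<in> {2..k}" "i l < i 1" for l
        using E(2)[of l] that by simp
      show "l \<in> {1..k}" "A \<in> block d (i l)" by (fact l)+
    qed (use asym B in \<open>simp_all add: U_def\<close>)
  qed

  \<comment> \<open>The embedding into the manifold\<close>
  have DK: "complex_image \<iota> D \<subseteq> \<Delta>"
    using assms(9) by (simp add: induced_subcomplex_def D_def)
  have sub_D: "diamond_facet d (i l) \<subseteq> D" if "l \<in> {1..k}" for l
    unfolding D_def assms(7) by (rule diamond_facet_subset_diamond) (rule that)
  have inj: "inj_on \<iota> (\<Union>D)" using assms(8) by (simp add: D_def)
  have cell_D: "cell d A \<in> D" and cell_sub_D: "T \<subseteq> cell d A \<Longrightarrow> T \<in> D" if A: "A \<in> U" for A T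
  proof -
    obtain l where l: "l \<in> {1..k}" "A \<in> block d (i l)" using A by (auto simp: U_def)
    then have "cell d A \<in> diamond_facet d (i l)"
      using facets_diamond_facet[OF i[OF l(1)]] by (auto simp: facets_def)
    moreover from this have "T \<subseteq> cell d A \<Longrightarrow> T \<in> diamond_facet d (i l)"
      unfolding diamond_facet_eq[OF i[OF l(1)]] by blast
    ultimately show "cell d A \<in> D" "T \<subseteq> cell d A \<Longrightarrow> T \<in> D"
      using sub_D[OF l(1)] by blast+
  qed
  have image_sub: "\<iota> ` S \<subseteq> \<iota> ` T \<longleftrightarrow> S \<subseteq> T" if "S \<in> D" "T \<in> D" for S T
    using inj_on_image_subset_iff[OF inj, of S T] that by blast
  have card_\<iota>: "card (\<iota> ` S) = card S" if "S \<in> D" for S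
    by (rule card_image[OF inj_on_subset[OF inj]]) (rule Union_upper[OF that])
  have cell_facet: "\<iota> ` cell d A \<in> facets \<Delta>" if "A \<in> U" for A
  proof -
    have "card (\<iota> ` cell d A) = d + 1"
      using card_\<iota>[OF cell_D[OF that]] card_cell[OF U[OF that]] by simp
    moreover have "\<iota> ` cell d A \<in> \<Delta>"
      using cell_D[OF that] DK by (auto simp: complex_image_def)
    ultimately show ?thesis using manifold_facet_iff[OF manifold] by blast
  qed
  have set_facets: "set (map (\<lambda>H. \<iota> ` H) xs) =
    facets \<Delta> \<inter> (\<Union>j\<in>{1..k}. complex_image \<iota> (diamond_facet d (i j)))"
  proof (intro set_eqI iffI)
    fix X assume "X \<in> set (map (\<lambda>H. \<iota> ` H) xs)"
    then obtain A where A: "A \<in> U" "X = \<iota> ` cell d A" unfolding set_map set_xs by blast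
    then obtain l where l: "l \<in> {1..k}" "A \<in> block d (i l)" by (auto simp: U_def)
    then have "cell d A \<in> diamond_facet d (i l)"
      using facets_diamond_facet[OF i[OF l(1)]] by (auto simp: facets_def)
    then show "X \<in> facets \<Delta> \<inter> (\<Union>j\<in>{1..k}. complex_image \<iota> (diamond_facet d (i j)))"
      using A cell_facet l(1) unfolding complex_image_def by blast
  next
    fix X assume X: "X \<in> facets \<Delta> \<inter> (\<Union>j\<in>{1..k}. complex_image \<iota> (diamond_facet d (i j)))"
    then obtain l T where l: "l \<in> {1..k}" "T \<in> diamond_facet d (i l)" "X = \<iota> ` T"
      by (auto simp: complex_image_def)
    have "card X = card T" unfolding l(3) using l sub_D by (intro card_\<iota>) blast
    then have "card T = d + 1" using X manifold_facet_iff[OF manifold] by simp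
    then have "T \<in> facets (diamond_facet d (i l))" using diamond_facet_card[OF i] l by blast
    then obtain A where A: "T = cell d A" "A \<in> block d (i l)"
      unfolding facets_diamond_facet[OF i[OF l(1)]] by blast
    then have "A \<in> U" using l(1) by (auto simp: U_def)
    then show "X \<in> set (map (\<lambda>H. \<iota> ` H) xs)"
      unfolding set_map set_xs l(3) A(1) by (intro imageI)
  qed

  \<comment> \<open>Boundary ridges\<close>
  obtain AG where AG: "AG \<in> block d (i 1)" "G = cell d AG"
    using assms(13) facets_diamond_facet[OF i[OF one]] by auto
  have AGU: "AG \<in> U" using AG(1) one by (auto simp: U_def)
  have FD: "F \<in> D" "finite F"
    using cell_sub_D[OF AGU] assms(14) finite_subset[OF assms(14)] card_cell[OF U[OF AGU]]
    unfolding AG(2) by simp_all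
  have cardF: "card (\<iota> ` F) = d"
    using assms(11) card_\<iota>[OF FD(1)] by simp
  \<comment> \<open>The image of \<open>F\<close> lies in a generator of the boundary of the same
    cardinality, so it is that generator: a ridge in exactly one facet, which must be the image of
    \<open>G\<close>.\<close>
  have F_unique: "Y = \<iota> ` G" if Y: "Y \<in> facets \<Delta>" "\<iota> ` F \<subseteq> Y" for Y
  proof -
    have "\<iota> ` F \<in> manifold_boundary d \<Delta>" using assms(12) by blast
    then obtain R where R: "R \<in> \<Delta>" "card R = d" "card {H \<in> facets \<Delta>. R \<subseteq> H} = 1" "\<iota> ` F \<subseteq> R"
      by (auto simp: manifold_boundary_def generated_complex_def)
    have "\<iota> ` F = R"
      using card_subset_eq[OF manifold_face_finite[OF manifold R(1)] R(4)] cardF R(2) by simp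
    with R(3) have "is_singleton {H \<in> facets \<Delta>. \<iota> ` F \<subseteq> H}"
      by (simp add: is_singleton_altdef)
    then obtain Z where Z: "{H \<in> facets \<Delta>. \<iota> ` F \<subseteq> H} = {Z}"
      by (rule is_singletonE)
    have "\<iota> ` G \<in> {H \<in> facets \<Delta>. \<iota> ` F \<subseteq> H}"
      using cell_facet[OF AGU] image_mono[OF assms(14), of \<iota>] unfolding AG(2) by simp
    moreover have "Y \<in> {H \<in> facets \<Delta>. \<iota> ` F \<subseteq> H}" using Y by simp
    ultimately show ?thesis unfolding Z by simp
  qed
  \<comment> \<open>Otherwise the ridge is on the boundary, hence inside \<open>F\<close> by the
    intersection hypothesis, and equal cardinalities make it \<open>F\<close>.\<close>
  have second: "\<exists>X\<in>facets \<Delta>. \<iota> ` (cell d A - {u}) \<subseteq> X \<and> X \<noteq> \<iota> ` cell d A"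
    if A: "A \<in> U" and u: "u \<in> cell d A" and ne: "cell d A - {u} \<noteq> F" for A u
  proof (rule ccontr)
    let ?T = "cell d A - {u}"
    assume "\<not> ?thesis"
    then have "{H \<in> facets \<Delta>. \<iota> ` ?T \<subseteq> H} = {\<iota> ` cell d A}"
      using cell_facet[OF A] by blast
    then have c1: "card {H \<in> facets \<Delta>. \<iota> ` ?T \<subseteq> H} = 1" by simp
    have T: "?T \<in> D" using cell_sub_D[OF A] by blast
    have cardT: "card ?T = d" using card_cell[OF U[OF A]] u by simp
    have "card (\<iota> ` ?T) = d"
      using cardT card_\<iota>[OF T] by simp
    moreover have im: "\<iota> ` ?T \<in> complex_image \<iota> D" using T by (auto simp: complex_image_def)
    ultimately have "\<iota> ` ?T \<in> manifold_boundary d \<Delta>"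
      using subsetD[OF DK im] c1 unfolding manifold_boundary_def generated_complex_def
      by (intro CollectI bexI[of _ "\<iota> ` ?T"]) simp_all
    with im have "\<iota> ` ?T \<in> Pow (\<iota> ` F)"
      unfolding assms(12)[symmetric] D_def by (rule IntI)
    then have "\<iota> ` ?T \<subseteq> \<iota> ` F" by (rule PowD)
    then have "?T \<subseteq> F" unfolding image_sub[OF T FD(1)] .
    then have "?T = F" by (rule card_subset_eq[OF FD(2)]) (simp only: cardT assms(11))
    then show False using ne by contradiction
  qed

  \<comment> \<open>The shelling condition\<close>
  have shell: "relative_shelling \<Delta>
    (complex_diff \<Delta> (\<Union>j\<in>{1..k}. complex_image \<iota> (diamond_facet d (i j)))) (map (\<lambda>H. \<iota> ` H) xs)"
  proof (rule manifold_relative_shellingI[OF manifold _ set_facets])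
    have "inj_on (\<lambda>H. \<iota> ` H) (set xs)"
    proof (rule inj_onI)
      fix X Y assume XY: "X \<in> set xs" "Y \<in> set xs" "\<iota> ` X = \<iota> ` Y"
      then have "X \<in> D" "Y \<in> D" using cell_D unfolding set_xs by blast+
      with XY(3) show "X = Y" using image_sub[of X Y] image_sub[of Y X] by simp
    qed
    then show "distinct (map (\<lambda>H. \<iota> ` H) xs)" using xs_distinct by (simp add: distinct_map)
  next
    fix n assume "n < length (map (\<lambda>H. \<iota> ` H) xs)"
    then have n: "n < length xs" by simp
    define W where "W = {B \<in> U. cell d B \<in> set (drop n xs)}"
    obtain A where A: "A \<in> U" "xs ! n = cell d A" using nth_mem[OF n] set_xs by auto
    have drop: "set (drop n (map (\<lambda>H. \<iota> ` H) xs)) = (\<lambda>B. \<iota> ` cell d B) ` W"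
    proof -
      have "set (drop n xs) \<subseteq> cell d ` U" using set_drop_subset[of n xs] set_xs by simp
      then have "set (drop n xs) = cell d ` W" by (auto simp: W_def)
      then show ?thesis by (simp add: drop_map image_image)
    qed
    have W: "B \<in> W \<longleftrightarrow> B \<in> U \<and> (B = A \<or> before (cell d B) (cell d A))" for B
    proof (cases "B \<in> U")
      case True
      then have "cell d B = cell d A \<longleftrightarrow> B = A" using cell_inj[OF _ U U[OF A(1)]] by blast
      then show ?thesis
        using drop_iff[OF n, of "cell d B"] True unfolding W_def A(2) set_xs by simp
    qed (simp add: W_def)
    have WU: "B \<in> U" if "B \<in> W" for B using that by (simp add: W_def)
    have AW: "A \<in> W" using W A(1) by simp
    have nth: "map (\<lambda>H. \<iota> ` H) xs ! n = \<iota> ` cell d A" using n A(2) by simp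
    have ridge: "B' = B \<or> B' = sym_diff B {j}"
      if "B \<in> U" "B' \<in> U" "j \<le> d" "\<iota> ` (cell d B - {cell_vertex B j}) \<subseteq> \<iota> ` cell d B'" for B B' j
    proof -
      have T: "cell d B - {cell_vertex B j} \<in> D" using cell_sub_D[OF that(1)] by blast
      from that(4) show ?thesis
        unfolding image_sub[OF T cell_D[OF that(2)]]
          cell_ridge_subset[OF U[OF that(1)] U[OF that(2)] that(3)] .
    qed
    have diff: "\<iota> ` cell d B - {\<iota> u} = \<iota> ` (cell d B - {u})" if "B \<in> U" "u \<in> cell d B" for B u
      using inj_on_image_set_diff[OF inj, of "cell d B" "{u}"] cell_D[OF that(1)] that(2) by auto
    show "\<exists>R \<subseteq> map (\<lambda>H. \<iota> ` H) xs ! n.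
      (\<forall>v\<in>R. \<exists>X\<in>facets \<Delta>. map (\<lambda>H. \<iota> ` H) xs ! n - {v} \<subseteq> X \<and> X \<notin> set (drop n (map (\<lambda>H. \<iota> ` H) xs))) \<and>
      (\<forall>X\<in>set (drop n (map (\<lambda>H. \<iota> ` H) xs)). R \<subseteq> X \<longrightarrow>
        (\<forall>w\<in>X-R. \<forall>Y\<in>facets \<Delta>. X - {w} \<subseteq> Y \<longrightarrow> Y \<in> set (drop n (map (\<lambda>H. \<iota> ` H) xs))))"
    proof (cases "A = AG")
      case True
      have "B = A" if "B \<in> W" for B
      proof (rule ccontr)
        assume "B \<noteq> A"
        with that W have "before (cell d B) G" using True AG(2) by blast
        then obtain l l' where l: "l \<in> {1..k}" "l' \<in> {1..k}" "G \<in> set (Fs l')"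
          "l < l' \<or> l = l' \<and> deglex_less d (i l) (initial_facet d i G l) (cell d B) G"
          unfolding before_def by blast
        have "G \<in> set (Fs 1)" using AG cell_Fs[OF one block_subset[OF AG(1)]] by simp
        then have "l' = 1" using Fs_unique[OF l(2) one l(3)] by simp
        with l have "deglex_less d (i 1) G (cell d B) G" by (auto simp: initial_facet_def)
        \<comment> \<open>\<open>G\<close> is the reference facet of its own block and has degree 0,
          so nothing precedes it.\<close>
        moreover have "dl_phi G G t = 0" for t by (simp add: dl_phi_def)
        ultimately show False by (auto simp: deglex_less_def dl_deg_def)
      qed
      with AW have WA: "W = {A}" by blast
      have G: "cell d A = G" using True AG(2) by simp
      \<comment> \<open>The witness is \<open>F\<close>. For \<open>u\<close> in \<open>F\<close>
        the ridge \<open>G - {u}\<close> differs from \<open>F\<close> and has a second facet;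
        removing a vertex outside \<open>F\<close> leaves a set whose only facet is
        \<open>G\<close>.\<close>
      show ?thesis unfolding drop nth WA image_insert image_empty G
      proof (intro exI[of _ "\<iota> ` F"] conjI ballI impI)
        show "\<iota> ` F \<subseteq> \<iota> ` G" using assms(14) by blast
        show "\<exists>X\<in>facets \<Delta>. \<iota> ` G - {v} \<subseteq> X \<and> X \<notin> {\<iota> ` G}" if v: "v \<in> \<iota> ` F" for v
        proof -
          obtain u where u: "u \<in> F" "v = \<iota> u" using v by blast
          have "G - {u} \<noteq> F" using u by blast
          then show ?thesis
            using second[of A u] A(1) u diff[OF A(1), of u] assms(14) unfolding G by auto
        qed
        show "Y \<in> {\<iota> ` G}"
          if "X \<in> {\<iota> ` G}" "w \<in> X - \<iota> ` F" "Y \<in> facets \<Delta>" "X - {w} \<subseteq> Y" for X w Y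
        proof -
          have "\<iota> ` F \<subseteq> X - {w}" using that(1,2) image_mono[OF assms(14), of \<iota>] by blast
          then show ?thesis using F_unique[OF that(3)] that(4) by simp
        qed
      qed
    next
      case False
      \<comment> \<open>Positions whose flip is still to be added. \<open>R\<close> keeps the
        vertices of \<open>A\<close> in the other positions, so the cells containing it form the
        subcube through \<open>A\<close> with directions \<open>C\<close>.\<close>
      define C where "C = {j. j \<le> d \<and> sym_diff A {j} \<in> W}"
      define R where "R = cell_vertex A ` ({0..d} - C)"
      have cell_A: "cell d A = cell_vertex A ` {0..d}" using cell_alt[OF U[OF A(1)]] .
      have flipW: "B \<in> W" if "sym_diff A B \<subseteq> C" for B
      proof -
        have "B = A \<or> B \<in> U \<and> before (cell d B) (cell d A)"
        proof (rule flip[OF A(1)])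
          fix j assume "j \<in> sym_diff A B"
          then have "j \<le> d" "sym_diff A {j} \<in> W" using that by (auto simp: C_def)
          moreover from W[THEN iffD1, OF this(2)]
          have "sym_diff A {j} \<in> U" "sym_diff A {j} = A \<or> before (cell d (sym_diff A {j})) (cell d A)"
            by (rule conjunct1, rule conjunct2)
          moreover have "sym_diff A {j} \<noteq> A" by blast
          ultimately show "j \<le> d \<and> sym_diff A {j} \<in> U \<and> before (cell d (sym_diff A {j})) (cell d A)"
            by (elim disjE) simp_all
        qed
        then show ?thesis by (intro W[THEN iffD2]) (use A(1) in blast)
      qed
      show ?thesis unfolding drop nth
      proof (intro exI[of _ "\<iota> ` R"] conjI ballI impI)
        show "\<iota> ` R \<subseteq> \<iota> ` cell d A" unfolding cell_A R_def by blast
      next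
        fix v assume "v \<in> \<iota> ` R"
        then obtain j where j: "v = \<iota> (cell_vertex A j)" "j \<le> d" "j \<notin> C" by (auto simp: R_def)
        have jA: "cell_vertex A j \<in> cell d A" using cell_vertex_in_cell_iff[OF j(2)] by simp
        \<comment> \<open>Only the image of \<open>G\<close> contains that of \<open>F\<close>, and
          \<open>A\<close> differs from \<open>AG\<close>.\<close>
        have "cell d A - {cell_vertex A j} \<noteq> F"
        proof
          assume "cell d A - {cell_vertex A j} = F"
          then have "\<iota> ` cell d A = \<iota> ` G"
            using F_unique[OF cell_facet[OF A(1)]] by blast
          then have "cell d A \<subseteq> cell d AG"
            using image_sub[OF cell_D[OF A(1)] cell_D[OF AGU]] AG(2) by simp
          then show False using cell_subset_iff[OF U[OF A(1)] U[OF AGU]] False by simp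
        qed
        then obtain X where X: "X \<in> facets \<Delta>" "\<iota> ` (cell d A - {cell_vertex A j}) \<subseteq> X" "X \<noteq> \<iota> ` cell d A"
          using second[OF A(1) jA] by blast
        \<comment> \<open>Among the cells only \<open>A\<close> and its flip at \<open>j\<close>
          contain this ridge, and the flip is not in \<open>W\<close> because \<open>j\<close> is
          outside \<open>C\<close>. The facet \<open>X\<close> may lie outside the diamond
          altogether.\<close>
        have "X \<notin> (\<lambda>B. \<iota> ` cell d B) ` W"
        proof
          assume "X \<in> (\<lambda>B. \<iota> ` cell d B) ` W"
          then obtain B where B: "B \<in> W" "X = \<iota> ` cell d B" by blast
          then have "B \<in> U" using WU by simp
          then have "B = A \<or> B = sym_diff A {j}" using ridge[OF A(1) _ j(2), of B] X(2) B(2) by simp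
          then show False
          proof
            assume "B = sym_diff A {j}"
            then have "j \<in> C" using B(1) j(2) unfolding C_def by simp
            then show False using j(3) by contradiction
          qed (use X(3) B(2) in simp)
        qed
        then show "\<exists>X\<in>facets \<Delta>. \<iota> ` cell d A - {v} \<subseteq> X \<and> X \<notin> (\<lambda>B. \<iota> ` cell d B) ` W"
          using X(1,2) unfolding j(1) diff[OF A(1) jA] by blast
      next
        fix X w Y
        assume X: "X \<in> (\<lambda>B. \<iota> ` cell d B) ` W" and RX: "\<iota> ` R \<subseteq> X" and w: "w \<in> X - \<iota> ` R"
          and Y: "Y \<in> facets \<Delta>" "X - {w} \<subseteq> Y"
        obtain A' where A': "A' \<in> W" "X = \<iota> ` cell d A'" using X by blast
        have A'U: "A' \<in> U" using WU[OF A'(1)] .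
        have "R \<subseteq> cell d A" unfolding cell_A R_def by blast
        then have "R \<in> D" by (rule cell_sub_D[OF A(1)])
        from image_sub[OF this cell_D[OF A'U]] have RA': "R \<subseteq> cell d A'" using RX A'(2) by simp
        have agree: "j \<in> A \<longleftrightarrow> j \<in> A'" if "j \<le> d" "j \<notin> C" for j
        proof -
          have "cell_vertex A j \<in> R" using that by (simp add: R_def)
          with RA' show ?thesis using cell_vertex_in_cell_iff[OF that(1), of A A'] by blast
        qed
        have AA': "sym_diff A A' \<subseteq> C"
        proof
          fix j assume j: "j \<in> sym_diff A A'"
          then have "j \<le> d" using U[OF A(1)] U[OF A'U] by auto
          with agree[of j] j show "j \<in> C" by blast
        qed
        obtain j where j: "j \<le> d" "w = \<iota> (cell_vertex A' j)"
          using w A'(2) cell_alt[OF U[OF A'U]] by auto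
        have "j \<in> C"
        proof (rule ccontr)
          assume "j \<notin> C"
          then have "cell_vertex A' j \<in> R"
            using agree[OF j(1)] j(1) by (simp add: R_def cell_vertex_def)
          then show False using w j(2) by blast
        qed
        \<comment> \<open>\<open>A'\<close> and \<open>B\<close> both lie in the subcube and share
          the ridge, which leaves no room for a third facet \<open>Y\<close>.\<close>
        define B where "B = sym_diff A' {j}"
        have BW: "B \<in> W" using AA' \<open>j \<in> C\<close> by (intro flipW) (unfold B_def, blast)
        then have BU: "B \<in> U" by (rule WU)
        let ?T = "cell d A' - {cell_vertex A' j}"
        have jA': "cell_vertex A' j \<in> cell d A'" using cell_vertex_in_cell_iff[OF j(1)] by simp
        have T: "?T \<in> D" using cell_sub_D[OF A'U] by blast
        have "card ?T = d" "finite ?T" using card_cell[OF U[OF A'U]] jA' by simp_all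
        then have T': "card (\<iota> ` ?T) = d" "finite (\<iota> ` ?T)"
          using card_\<iota>[OF T] by simp_all
        have TB: "\<iota> ` ?T \<subseteq> \<iota> ` cell d B"
          unfolding image_sub[OF T cell_D[OF BU]] cell_ridge_subset[OF U[OF A'U] U[OF BU] j(1)]
          by (simp only: B_def simp_thms)
        have TA: "\<iota> ` ?T \<subseteq> \<iota> ` cell d A'" by blast
        have TY: "\<iota> ` ?T \<subseteq> Y" using Y(2) diff[OF A'U jA'] A'(2) j(2) by simp
        have "B \<noteq> A'" unfolding B_def by blast
        then have "\<iota> ` cell d A' \<noteq> \<iota> ` cell d B"
          using image_sub[OF cell_D[OF A'U] cell_D[OF BU]] cell_subset_iff[OF U[OF A'U] U[OF BU]] by auto
        then have "Y = \<iota> ` cell d A' \<or> Y = \<iota> ` cell d B"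
          using manifold_ridge_in_two_facets[OF manifold T' cell_facet[OF A'U] TA cell_facet[OF BU] TB Y(1) TY]
          by auto
        then show "Y \<in> (\<lambda>B. \<iota> ` cell d B) ` W" using A'(1) BW by blast
      qed
    qed
  qed
  then show ?thesis by (simp only: xs_def)
qed

end
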